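(* Let $\mu$ be a Borel probability measure on the $q$-dimensional torus $\mathbb{T}^q=\mathbb{R}^q/\mathbb{Z}^q$, and let $\mathrm{Homeo}_\mu(\mathbb{T}^q)$ denote the group of homeomorphisms of $\mathbb{T}^q$ that preserve the measure $\mu$. Then any finitely generated periodic subgroup of $\mathrm{Homeo}_\mu(\mathbb{T}^q)$ is finite.
   Context: A group is periodic if each of its elements has finite order. A homeomorphism $f$ preserves $\mu$ if $f_*\mu=\mu$. *)

theory Defs
  imports "HOL-Probability.Probability" "HOL-Algebra.Generated_Groups"
begin

definition torus_rel :: "real ^ 'q \<Rightarrow> real ^ 'q \<Rightarrow> bool"
  where "torus_rel x y \<longleftrightarrow> (\<forall>i. x $ i - y $ i \<in> \<int>)"

lemma equivp_torus_rel: "equivp torus_rel"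
proof (rule equivpI)
  show "reflp torus_rel"
    by (simp add: reflp_def torus_rel_def)
  show "symp torus_rel"
    unfolding symp_def torus_rel_def by (metis Ints_minus minus_diff_eq)
  show "transp torus_rel"
  proof (rule transpI)
    fix x y z :: "real ^ 'q"
    assume xy: "torus_rel x y" and yz: "torus_rel y z"
    have "(x $ i - y $ i) + (y $ i - z $ i) \<in> \<int>" for i
      using xy yz by (intro Ints_add) (simp_all add: torus_rel_def)
    then show "torus_rel x z"
      by (simp add: torus_rel_def)
  qed
qed

quotient_type (overloaded) 'q torus = "real ^ 'q::finite" / torus_rel
  by (rule equivp_torus_rel)

text \<open>The torus carries the quotient topology, so that \<open>borel\<close> on it is its Borel sigma-algebra.\<close>

instantiation torus :: (finite) topological_space
begin

definition open_torus :: "'a torus set \<Rightarrow> bool"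
  where "open_torus U \<longleftrightarrow> open (abs_torus -` U)"

instance
  by standard (auto simp: open_torus_def vimage_Union)

end

definition Homeo_preserving :: "'a::topological_space measure \<Rightarrow> ('a \<Rightarrow> 'a) monoid"
  where "Homeo_preserving \<mu> =
    \<lparr>carrier = {f. (\<exists>g. homeomorphism UNIV UNIV f g) \<and> distr \<mu> borel f = \<mu>},
     mult = (\<circ>), one = id\<rparr>"

definition periodic_group :: "('a, 'b) monoid_scheme \<Rightarrow> bool"
  where "periodic_group G \<longleftrightarrow>
    (\<forall>x\<in>carrier G. \<exists>n::nat. n > 0 \<and> x [^]\<^bsub>G\<^esub> n = \<one>\<^bsub>G\<^esub>)"

definition finitely_generated_group :: "('a, 'b) monoid_scheme \<Rightarrow> bool"
  where "finitely_generated_group G \<longleftrightarrow>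
    (\<exists>S. finite S \<and> S \<subseteq> carrier G \<and> generate G S = carrier G)"

lemma group_Homeo_preserving:
  assumes "sets \<mu> = sets borel"
  shows "group (Homeo_preserving \<mu>)"
proof (rule groupI)
  have meas: "f \<in> measurable \<mu> borel" "g \<in> measurable \<mu> borel"
      "f \<in> measurable borel borel" "g \<in> measurable borel borel"
    if "homeomorphism UNIV UNIV f g" for f g :: "'a \<Rightarrow> 'a"
    using that unfolding measurable_cong_sets[OF assms refl]
    by (auto simp: homeomorphism_def intro!: borel_measurable_continuous_onI)
  show "x \<otimes>\<^bsub>Homeo_preserving \<mu>\<^esub> y \<in> carrier (Homeo_preserving \<mu>)"
    if x: "x \<in> carrier (Homeo_preserving \<mu>)" and y: "y \<in> carrier (Homeo_preserving \<mu>)" for x y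
  proof -
    obtain x' y' where h: "homeomorphism UNIV UNIV x x'" "homeomorphism UNIV UNIV y y'"
      using x y by (auto simp: Homeo_preserving_def)
    have "distr \<mu> borel (x \<circ> y) = distr (distr \<mu> borel y) borel x"
      by (rule distr_distr[symmetric]) (use meas[OF h(1)] meas[OF h(2)] in auto)
    then show ?thesis
      using x y homeomorphism_compose[OF h(2,1)] by (auto simp: Homeo_preserving_def)
  qed
  show "\<one>\<^bsub>Homeo_preserving \<mu>\<^esub> \<in> carrier (Homeo_preserving \<mu>)"
    using distr_id2[OF assms[symmetric]] homeomorphism_ident[of UNIV]
    by (auto simp: Homeo_preserving_def id_def)
  show "\<exists>y\<in>carrier (Homeo_preserving \<mu>). y \<otimes>\<^bsub>Homeo_preserving \<mu>\<^esub> x = \<one>\<^bsub>Homeo_preserving \<mu>\<^esub>"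
    if x: "x \<in> carrier (Homeo_preserving \<mu>)" for x
  proof -
    obtain x' where h: "homeomorphism UNIV UNIV x x'" and d: "distr \<mu> borel x = \<mu>"
      using x by (auto simp: Homeo_preserving_def)
    have id: "x' \<circ> x = id"
      using h by (auto simp: homeomorphism_def)
    have "distr \<mu> borel x' = distr (distr \<mu> borel x) borel x'"
      using d by simp
    also have "\<dots> = distr \<mu> borel (x' \<circ> x)"
      by (rule distr_distr) (use meas[OF h] in auto)
    also have "\<dots> = \<mu>"
      using distr_id2[OF assms[symmetric]] by (simp add: id id_def)
    finally show ?thesis
      using id homeomorphism_symD[OF h] by (auto simp: Homeo_preserving_def)
  qed
qed (auto simp: Homeo_preserving_def comp_assoc)

end

theory Submission
  imports Defs "HOL-Homology.Homology"
begin

text \<open>The group acts on \<open>H\<^sub>1\<close> of the torus, that is on \<open>\<int>\<^sup>q\<close>, by the linear parts of lifts to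
  \<open>\<real>\<^sup>q\<close> (\<open>homology_action\<close>). The elements that act as the identity modulo 9 form a
  subgroup \<open>N\<close> of finite index, and since they have finite order they act as the identity
  over the integers (Minkowski's argument, \<open>finite_order_congruent_identity\<close>). So every element
  of \<open>N\<close> has lifts that commute with all integer translations.

  Such a lift \<open>F\<close> has a periodic, hence bounded, displacement \<open>F x - x\<close>, and because the
  measure is invariant the mean displacement turns composition into addition
  (\<open>mean_displacement_compose\<close>). A commutator of elements of \<open>N\<close> therefore has a lift \<open>V\<close> with
  mean displacement 0. Its power of the right order is an integer translation with mean
  displacement 0, that is the identity, so \<open>V\<close> is a homeomorphism of \<open>\<real>\<^sup>q\<close> of finite order with
  bounded displacement.

  By a theorem of Newman type (\<open>bounded_displacement_finite_period\<close>) such a map is the identity.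
  It may be assumed that \<open>F\<close> has prime period \<open>p\<close>. The average \<open>h\<close> of the iterates of \<open>F\<close> has
  bounded displacement, hence degree 1; it satisfies \<open>h \<circ> F = h\<close>, and it fixes the fixed
  points of \<open>F\<close>. If \<open>y\<close> is not fixed by \<open>F\<close>, the fibre of \<open>h\<close> over \<open>y\<close> contains no fixed point, so
  \<open>F\<close> permutes it freely and the degree is a multiple of \<open>p\<close>, a contradiction. To count the fibre
  it has to be cut into \<open>p\<close> pieces that \<open>F\<close> permutes cyclically; a small \<open>F\<close>-invariant perturbation
  of \<open>h\<close> makes this possible. The degree is computed with singular chains, in
  \<open>freely_permuted_fibre_impossible\<close>.

  So \<open>N\<close> is abelian, and a finitely generated periodic group with an abelian subgroup of
  finite index is finite (\<open>finite_if_abelian_finite_index\<close>).\<close>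

section \<open>The local homology of Euclidean space\<close>

text \<open>The dimension shift for complements of closed sets reduces this to \<open>\<real>\<^sup>0\<close>, where the complement
  of the point is empty and the group is \<open>H\<^sub>0\<close> of a point.\<close>

lemma relative_homology_euclidean_punctured:
  fixes y :: "'a::euclidean_space"
  shows "relative_homology_group (int DIM('a)) euclidean (-{y}) \<cong> integer_group"
proof -
  let ?n = "DIM('a)" and ?E = "Euclidean_space DIM('a)" and ?z = "\<lambda>i::nat. 0::real"
  have z: "?z \<in> topspace (Euclidean_space k)" for k
    by (simp add: topspace_Euclidean_space)
  obtain f :: "(nat \<Rightarrow> real) \<Rightarrow> 'a" and g where fg: "homeomorphic_maps ?E euclidean f g"
    using homeomorphic_maps_Euclidean_space_euclidean .
  define f' where "f' = (\<lambda>x. (y - f ?z) + x) \<circ> f"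
  have "homeomorphic_maps euclidean euclidean (\<lambda>x. (y - f ?z) + x) (\<lambda>x. -(y - f ?z) + x)"
    by (auto simp: homeomorphic_maps_def intro!: continuous_intros)
  then have "homeomorphic_map euclidean euclidean (\<lambda>x. (y - f ?z) + x)"
    by (rule homeomorphic_maps_map[THEN iffD1, THEN conjunct1])
  then have hom: "homeomorphic_map ?E euclidean f'"
    unfolding f'_def using fg homeomorphic_map_compose homeomorphic_maps_map by blast
  have im: "f' ` (topspace ?E - {?z}) = -{y}"
  proof -
    have inj: "inj_on f' (topspace ?E)" and sur: "f' ` topspace ?E = UNIV"
      using hom by (auto simp: homeomorphic_eq_everything_map)
    have "f' ?z = y" by (simp add: f'_def)
    then show ?thesis
      using inj_on_image_set_diff[OF inj, of "topspace ?E" "{?z}"] sur z by auto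
  qed
  have "relative_homology_group (int ?n) ?E (topspace ?E - {?z}) \<cong> relative_homology_group (int ?n) euclidean (-{y})"
    using homeomorphic_map_relative_homology_iso[OF hom _ im] is_isoI by blast
  moreover have "homology_group 0 (Euclidean_space 0) \<cong> integer_group"
    by (rule homology_coefficients[of _ ?z]) (auto simp: topspace_Euclidean_space)
  moreover have "homology_group 0 (Euclidean_space 0) \<cong> relative_homology_group (int ?n) ?E (topspace ?E - {?z})"
  proof -
    have 0: "topspace (Euclidean_space 0) = {?z}"
      by (auto simp: topspace_Euclidean_space)
    have "closedin (Euclidean_space 0) {?z}"
      using closedin_topspace[of "Euclidean_space 0"] unfolding 0 .
    from relative_homology_group_Euclidean_complement_step[OF this, of 0 ?n] show ?thesis
      unfolding 0 by simp
  qed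
  ultimately show ?thesis
    by (meson group.iso_sym group_relative_homology_group iso_trans)
qed

text \<open>Homology classes are cosets, and their group operation is a sum of sets; the next two lemmas
  turn it into arithmetic of representing chains.\<close>

lemma homology_class_add:
  "homologous_rel_set p X S a \<otimes>\<^bsub>relative_homology_group (int p) X S\<^esub> homologous_rel_set p X S b
    = homologous_rel_set p X S (a + b)"
proof -
  have "\<exists>r. homologous_rel p X S a r \<and> homologous_rel p X S b (c - r)" if "homologous_rel p X S (a + b) c" for c
  proof (intro exI conjI)
    have "homologous_rel p X S (a + b - a) (c - a)"
      by (rule homologous_rel_diff) (use that in auto)
    then show "homologous_rel p X S b (c - a)" by simp
  qed auto
  then have "\<exists>r s. homologous_rel p X S a r \<and> homologous_rel p X S b s \<and> c = r + s" if "homologous_rel p X S (a + b) c" for c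
    using that by (metis add.commute diff_add_cancel)
  then show ?thesis
    by (auto simp: mult_relative_homology_group intro: homologous_rel_add)
qed

lemma homology_class_multiple:
  "homologous_rel_set p X S d [^]\<^bsub>relative_homology_group (int p) X S\<^esub> (n::nat)
    = homologous_rel_set p X S (frag_cmul (int n) d)"
proof (induction n)
  case 0
  then show ?case
    using homologous_rel_set_eq_relboundary[of p X S 0] by simp
next
  case (Suc n)
  then show ?case
    by (simp add: homology_class_add frag_cmul_distrib add.commute)
qed

text \<open>A generator of the infinite cyclic local homology group. Its indivisibility is what the
  count of a freely permuted fibre contradicts.\<close>

lemma indivisible_relcycle_exists:
  fixes y :: "'a::euclidean_space"
  assumes "p \<ge> (2::nat)"
  obtains c where "singular_relcycle DIM('a) euclidean (-{y}) c"
    "\<And>d. singular_relcycle DIM('a) euclidean (-{y}) d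
      \<Longrightarrow> \<not> homologous_rel DIM('a) euclidean (-{y}) c (frag_cmul (int p) d)"
proof -
  let ?n = "DIM('a)"
  let ?G = "relative_homology_group (int ?n) (euclidean :: 'a topology) (-{y})"
  let ?cl = "homologous_rel_set ?n euclidean (-{y})"
  obtain \<phi> where \<phi>: "\<phi> \<in> iso ?G integer_group"
    using relative_homology_euclidean_punctured[of y] by (auto simp: is_iso_def)
  then interpret group_hom ?G integer_group \<phi>
    by (simp add: group_hom_def group_hom_axioms_def iso_def)
  have "\<phi> ` carrier ?G = UNIV"
    using \<phi> by (auto simp: iso_def bij_betw_def)
  then obtain x where x: "x \<in> carrier ?G" "\<phi> x = 1"
    by (metis UNIV_I imageE)
  then obtain c where c: "singular_relcycle ?n euclidean (-{y}) c" "x = ?cl c"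
    by (auto simp: carrier_relative_homology_group)
  show thesis
  proof (rule that[OF c(1)])
    fix d :: "'a chain" assume d: "singular_relcycle ?n euclidean (-{y}) d"
    then have dc: "?cl d \<in> carrier ?G"
      by (auto simp: carrier_relative_homology_group)
    show "\<not> homologous_rel ?n euclidean (-{y}) c (frag_cmul (int p) d)"
    proof
      assume "homologous_rel ?n euclidean (-{y}) c (frag_cmul (int p) d)"
      then have "x = ?cl (frag_cmul (int p) d)"
        using c homologous_rel_set_eq by blast
      then have "1 = \<phi> (?cl d [^]\<^bsub>?G\<^esub> p)"
        using x by (simp add: homology_class_multiple)
      also have "\<dots> = int p * \<phi> (?cl d)"
        using hom_nat_pow[OF dc] by (simp add: int_pow_int[symmetric] del: int_pow_int)
      finally have "int p dvd 1" by (metis dvd_triv_left)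
      then show False using assms by simp
    qed
  qed
qed

section \<open>Relative cycles, straight-line homotopies and spreading\<close>

lemma homologous_rel_mono:
  assumes "homologous_rel p X S a b" "S \<subseteq> T"
  shows "homologous_rel p X T a b"
  using assms unfolding homologous_rel_def singular_relboundary_def mod_subset_def
  by (auto intro: singular_chain_mono)

lemma singular_relcycle_mono:
  assumes "singular_relcycle p X S c" "S \<subseteq> T"
  shows "singular_relcycle p X T c"
  using assms unfolding singular_relcycle by (auto intro: singular_chain_mono)

lemma homologous_rel_chain_map:
  assumes "homologous_rel p X S a b" "continuous_map X Y g" "g \<in> S \<rightarrow> T"
  shows "homologous_rel p Y T (chain_map p g a) (chain_map p g b)"
  using singular_relboundary_chain_map[of p X S "a - b" Y g T] assms
  unfolding homologous_rel_def by (simp add: chain_map_diff)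

lemma homologous_rel_straight_line:
  fixes f g :: "'a::topological_space \<Rightarrow> 'b::real_normed_vector"
  assumes "continuous_on UNIV f" "continuous_on UNIV g"
    and "\<And>x. x \<in> S \<Longrightarrow> closed_segment (f x) (g x) \<subseteq> T"
    and "singular_relcycle q euclidean S c"
  shows "homologous_rel q euclidean T (chain_map q f c) (chain_map q g c)"
proof (rule homotopic_imp_homologous_rel_chain_maps[OF _ assms(4)])
  define h where "h = (\<lambda>(t, x). (1 - t) *\<^sub>R f x + t *\<^sub>R g x)"
  have 1: "prod_topology (top_of_set {0..1::real}) (euclidean :: 'a topology) = top_of_set ({0..1} \<times> UNIV)"
    using subtopology_Times[of "euclidean :: real topology" "euclidean :: 'a topology" "{0..1}" UNIV]
    by simp
  have "continuous_on ({0..1} \<times> UNIV) (\<lambda>z. (1 - fst z) *\<^sub>R f (snd z) + fst z *\<^sub>R g (snd z))"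
    by (intro continuous_intros continuous_on_compose2[OF assms(1)] continuous_on_compose2[OF assms(2)]) auto
  then have cont: "continuous_map (prod_topology (top_of_set {0..1}) euclidean) euclidean h"
    unfolding 1 by (simp add: h_def case_prod_unfold)
  show "homotopic_with (\<lambda>h. h \<in> S \<rightarrow> T) euclidean euclidean f g"
    unfolding homotopic_with_def
  proof (intro exI conjI ballI allI)
    show "continuous_map (prod_topology (top_of_set {0..1}) euclidean) euclidean h" by (rule cont)
    show "(\<lambda>x. h (t, x)) \<in> S \<rightarrow> T" if "t \<in> {0..1}" for t
      using that assms(3) by (fastforce simp: h_def closed_segment_def)
  qed (auto simp: h_def)
qed

text \<open>The boundary of a chain is supported on finitely many compact images of simplices, so it keeps
  a positive distance from the point that it misses.\<close>

lemma relcycle_support_away: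
  fixes y :: "'a::real_normed_vector"
  assumes "singular_relcycle q euclidean (-{y}) c"
  obtains \<delta> where "\<delta> > 0" "singular_relcycle q euclidean (- ball y \<delta>) c"
proof -
  let ?b = "chain_boundary q c"
  have b: "singular_chain (q-1) euclidean ?b"
     and out: "\<forall>f\<in>Poly_Mapping.keys ?b. f ` standard_simplex (q-1) \<subseteq> -{y}"
    using assms by (auto simp: singular_relcycle singular_chain_subtopology)
  define C where "C = (\<Union>f\<in>Poly_Mapping.keys ?b. f ` standard_simplex (q-1))"
  have "compact (f ` standard_simplex (q-1))" if "f \<in> Poly_Mapping.keys ?b" for f
  proof -
    have "continuous_map (subtopology (powertop_real UNIV) (standard_simplex (q-1))) euclidean f"
      using b that by (auto simp: singular_chain_def singular_simplex_def)
    moreover have "compactin (subtopology (powertop_real UNIV) (standard_simplex (q-1))) (standard_simplex (q-1))"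
      by (simp add: compactin_subtopology compactin_standard_simplex)
    ultimately have "compactin euclidean (f ` standard_simplex (q-1))"
      by (rule image_compactin[rotated])
    then show ?thesis by simp
  qed
  then have "compact C" unfolding C_def by (intro compact_UN) auto
  then have "open (-C)" by (auto intro: compact_imp_closed)
  moreover have "y \<in> -C" using out by (auto simp: C_def)
  ultimately obtain \<delta> where \<delta>: "\<delta> > 0" "ball y \<delta> \<subseteq> -C"
    by (meson open_contains_ball)
  show thesis
  proof (rule that[OF \<delta>(1)])
    show "singular_relcycle q euclidean (- ball y \<delta>) c"
      using assms \<delta>(2) b unfolding singular_relcycle singular_chain_subtopology[of "q-1"]
      by (auto simp: C_def)
  qed
qed

text \<open>Dilating about \<open>y\<close> by a large factor moves the boundary out of any given ball, along segments
  that avoid \<open>y\<close>. Afterwards maps with bounded displacement can be compared with the identity by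
  straight lines without touching the region of interest.\<close>

lemma relcycle_spread:
  fixes y :: "'a::real_normed_vector"
  assumes c: "singular_relcycle q euclidean (-{y}) c"
  obtains c' where "singular_relcycle q euclidean (- ball y R) c'"
    "homologous_rel q euclidean (-{y}) c c'"
proof -
  obtain \<delta> where \<delta>: "\<delta> > 0" "singular_relcycle q euclidean (- ball y \<delta>) c"
    using relcycle_support_away[OF c] .
  define t where "t = max 1 (R / \<delta>)"
  have t: "t \<ge> 1" "R \<le> t * \<delta>"
    using \<delta>(1) by (auto simp: t_def field_simps max_def)
  \<comment> \<open>the dilation about \<open>y\<close> that takes the ball of radius \<open>\<delta>\<close> to one of radius at least \<open>R\<close>\<close>
  define g where "g = (\<lambda>x. y + t *\<^sub>R (x - y))"
  have contg: "continuous_on UNIV g" unfolding g_def by (intro continuous_intros)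
  show thesis
  proof (rule that)
    have "dist y (g x) = t * dist y x" for x
      using t by (simp add: g_def dist_norm norm_minus_commute)
    moreover have "t * \<delta> \<le> t * dist y x" if "\<delta> \<le> dist y x" for x
      using t that by (intro mult_left_mono) auto
    ultimately have "g \<in> - ball y \<delta> \<rightarrow> - ball y R"
      using t by (fastforce simp: not_less)
    then show "singular_relcycle q euclidean (- ball y R) (chain_map q g c)"
      using singular_relcycle_chain_map[OF \<delta>(2), of euclidean g] contg by simp
    have "homologous_rel q euclidean (-{y}) (chain_map q id c) (chain_map q g c)"
    proof (rule homologous_rel_straight_line[OF _ contg _ c])
      fix x assume x: "x \<in> -{y}"
      have "y \<noteq> (1 - u) *\<^sub>R x + u *\<^sub>R g x" if "0 \<le> u" "u \<le> 1" for u
      proof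
        assume "y = (1 - u) *\<^sub>R x + u *\<^sub>R g x"
        then have "(1 - u + u * t) *\<^sub>R (x - y) = 0"
          by (simp add: g_def algebra_simps)
        moreover have "1 - u + u * t \<ge> 1 - u + u * 1"
          using t that by (intro add_left_mono mult_left_mono) auto
        ultimately show False using x by auto
      qed
      then show "closed_segment (id x) (g x) \<subseteq> -{y}"
        by (auto simp: closed_segment_def)
    qed auto
    then show "homologous_rel q euclidean (-{y}) c (chain_map q g c)"
      using c chain_map_ident by (metis singular_relcycle)
  qed
qed

section \<open>Excision and localization of relative cycles\<close>

lemma iterated_subdivision_chain_boundary:
  assumes "singular_chain p X c"
  shows "singular_chain p X ((singular_subdivision p ^^ n) c)"
    and "chain_boundary p ((singular_subdivision p ^^ n) c)
      = (singular_subdivision (p - Suc 0) ^^ n) (chain_boundary p c)"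
proof (induction n)
  case (Suc n)
  case 1 show ?case using Suc by (simp add: singular_chain_singular_subdivision)
  case 2 show ?case using Suc by (simp add: chain_boundary_singular_subdivision)
qed (use assms in auto)

lemma homologous_rel_iterated_subdivision:
  assumes "singular_relcycle p X S c"
  shows "homologous_rel p X S ((singular_subdivision p ^^ n) c) c"
proof (induction n)
  case (Suc n)
  then have "singular_relcycle p X S ((singular_subdivision p ^^ n) c)"
    using assms homologous_rel_singular_relcycle by blast
  from homologous_rel_singular_subdivision[OF this] Suc show ?case
    by (auto intro: homologous_rel_trans)
qed auto

text \<open>Injectivity in excision, at the level of chains: a chain in the whole space that exhibits the
  homology is subdivided until each of its simplices lies in \<open>V\<close> or misses \<open>A\<close>, and only the part
  in \<open>V\<close> is kept.\<close>

lemma homologous_rel_excision: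
  fixes V :: "'a::topological_space set"
  assumes V: "open V" and A: "closed A" "A \<subseteq> V"
    and a: "singular_relcycle q (top_of_set V) (V - A) a"
    and b: "singular_relcycle q (top_of_set V) (V - A) b"
    and ab: "homologous_rel q euclidean (-A) a b"
  shows "homologous_rel q (top_of_set V) (V - A) a b"
proof -
  let ?s = "\<lambda>q n. singular_subdivision q ^^ n"
  have c: "singular_relcycle q (top_of_set V) (V - A) (a - b)"
    by (rule singular_relcycle_diff[OF a b])
  obtain d e where d: "singular_chain (Suc q) euclidean d"
    and e: "singular_chain q (top_of_set (-A)) e" and de: "chain_boundary (Suc q) d + e = a - b"
    using ab by (auto simp: homologous_rel_def singular_relboundary)
  have "euclidean closure_of (-V) \<subseteq> euclidean interior_of (-A)"
    using V A by (simp add: closure_closed closed_Compl interior_open open_Compl)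
  moreover have "singular_chain (Suc q) (top_of_set UNIV) d" using d by simp
  ultimately obtain n d' e' where d': "singular_chain (Suc q) (top_of_set (UNIV - -V)) d'"
    and e': "singular_chain (Suc q) (top_of_set (-A)) e'" and s: "?s (Suc q) n d = d' + e'"
    using excised_chain_exists[of euclidean "-V" "-A" UNIV "Suc q" d] by (metis subset_UNIV)
  have d'V: "singular_chain (Suc q) (top_of_set V) d'"
    using d' by simp
  have "chain_boundary (Suc q) d = (a - b) - e"
    using de by (simp add: algebra_simps)
  then have "chain_boundary (Suc q) d' + chain_boundary (Suc q) e' = ?s q n (a - b) - ?s q n e"
    using iterated_subdivision_chain_boundary(2)[OF d, of n]
    by (simp add: s chain_boundary_add singular_subdivision_power_diff)
  then have eq: "?s q n (a - b) - chain_boundary (Suc q) d' = ?s q n e + chain_boundary (Suc q) e'"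
    by (simp add: algebra_simps)
  have out: "singular_chain q (top_of_set (-A)) (?s q n (a - b) - chain_boundary (Suc q) d')"
    unfolding eq
    using iterated_subdivision_chain_boundary(1)[OF e] singular_chain_boundary[OF e']
    by (auto intro!: singular_chain_add)
  have "singular_chain q (top_of_set V) (?s q n (a - b))"
    using c by (intro iterated_subdivision_chain_boundary(1)) (auto simp: singular_relcycle)
  then have "singular_chain q (top_of_set V) (?s q n (a - b) - chain_boundary (Suc q) d')"
    using singular_chain_boundary[OF d'V] by (auto intro!: singular_chain_diff)
  with out have "singular_chain q (top_of_set (V - A)) (?s q n (a - b) - chain_boundary (Suc q) d')"
    unfolding singular_chain_subtopology by blast
  then have "singular_relboundary q (top_of_set V) (V - A) (?s q n (a - b))"
    unfolding singular_relboundary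
    by (intro exI[of _ d'] exI[of _ "?s q n (a - b) - chain_boundary (Suc q) d'"])
       (use d'V in \<open>auto simp: subtopology_subtopology Int_absorb1\<close>)
  moreover have "homologous_rel q (top_of_set V) (V - A) (?s q n (a - b)) (a - b)"
    by (rule homologous_rel_iterated_subdivision[OF c])
  ultimately show ?thesis
    unfolding homologous_rel_def using singular_relboundary_diff by fastforce
qed

text \<open>A cycle relative to the complement of \<open>K\<close> splits along a cover of \<open>K\<close> by disjoint open sets.
  After subdivision each simplex misses \<open>K\<close> or lies in one \<open>V i\<close>; the simplices of the
  second kind, sorted by \<open>i\<close>, form the pieces. This is the additivity of the local
  degree over the parts of a fibre.\<close>

lemma relcycle_decomposition:
  fixes V :: "'i \<Rightarrow> 'a::topological_space set"
  assumes fin: "finite I" and V: "\<And>i. i \<in> I \<Longrightarrow> open (V i)" and disj: "disjoint_family_on V I"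
    and K: "closed K" "K \<subseteq> (\<Union>i\<in>I. V i)"
    and c: "singular_relcycle q euclidean (-K) c"
  obtains cc where "\<And>i. i \<in> I \<Longrightarrow> singular_relcycle q (top_of_set (V i)) (V i - K) (cc i)"
    and "\<And>i. i \<in> I \<Longrightarrow> homologous_rel q euclidean (-(K \<inter> V i)) c (cc i)"
    and "homologous_rel q euclidean (-K) c (\<Sum>i\<in>I. cc i)"
proof -
  let ?\<Delta> = "standard_simplex q"
  obtain c' where c': "singular_relcycle q euclidean (-K) c'" "homologous_rel q euclidean (-K) c c'"
    and small: "\<And>f. f \<in> Poly_Mapping.keys c' \<Longrightarrow> \<exists>U\<in>insert (-K) (V ` I). f \<in> ?\<Delta> \<rightarrow> U"
    by (rule small_homologous_rel_relcycle_exists[OF _ _ c, of "insert (-K) (V ` I)"])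
       (use V K in \<open>auto simp: open_Compl\<close>)
  define part where "part P = frag_extend (\<lambda>f. if P f then frag_of f else 0) c'" for P :: "((nat \<Rightarrow> real) \<Rightarrow> 'a) \<Rightarrow> bool"
  have keys_part: "f \<in> Poly_Mapping.keys c' \<and> P f" if "f \<in> Poly_Mapping.keys (part P)" for P f
    using that keys_frag_extend[of "\<lambda>f. if P f then frag_of f else 0" c'] unfolding part_def
    by (auto split: if_splits)
  have chain_part: "singular_chain q euclidean (part P)" for P
    using c'(1) keys_part unfolding singular_relcycle singular_chain_def by blast
  define far where "far f \<longleftrightarrow> f ` ?\<Delta> \<subseteq> -K" for f
  define near where "near i f \<longleftrightarrow> f ` ?\<Delta> \<subseteq> V i \<and> \<not> far f" for i f
  define cc where "cc i = part (near i)" for i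
  have "c' = frag_extend frag_of c'" by (rule frag_expansion)
  also have "\<dots> = frag_extend (\<lambda>f. (if far f then frag_of f else 0) + (\<Sum>i\<in>I. if near i f then frag_of f else 0)) c'"
  proof (rule frag_extend_eq)
    fix f assume f: "f \<in> Poly_Mapping.keys c'"
    show "frag_of f = (if far f then frag_of f else 0) + (\<Sum>i\<in>I. if near i f then frag_of f else 0)"
    proof (cases "far f")
      case True
      then show ?thesis by (simp add: near_def)
    next
      case False
      with small[OF f] obtain j where j: "j \<in> I" "f ` ?\<Delta> \<subseteq> V j"
        by (auto simp: far_def)
      have "near i f \<longleftrightarrow> i = j" if "i \<in> I" for i
      proof
        assume "near i f"
        then have "V i \<inter> V j \<noteq> {}"
          using j nonempty_standard_simplex[of q] by (auto simp: near_def)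
        then show "i = j"
          using disj that j(1) by (auto simp: disjoint_family_on_def)
      qed (use j False in \<open>auto simp: near_def\<close>)
      then show ?thesis using False j fin by (simp cong: sum.cong)
    qed
  qed
  also have "\<dots> = part far + (\<Sum>i\<in>I. cc i)"
    unfolding part_def cc_def frag_extend_def
    by (subst sum.swap) (simp add: frag_cmul_distrib2 sum.distrib frag_cmul_sum)
  finally have sum: "c' = part far + (\<Sum>i\<in>I. cc i)" .
  have far: "singular_chain q (top_of_set (-K)) (part far)"
    unfolding singular_chain_subtopology using chain_part keys_part[of _ far] far_def by auto
  have cc: "singular_chain q (top_of_set (V i)) (cc i)" for i
    unfolding singular_chain_subtopology cc_def using chain_part keys_part[of _ "near i"]
    by (auto simp: near_def)
  have rest: "singular_chain q (top_of_set (-(K \<inter> V i))) (c' - cc i)" if i: "i \<in> I" for i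
  proof -
    have "c' - cc i = part far + (\<Sum>j\<in>I-{i}. cc j)"
      unfolding sum by (subst sum.remove[OF fin i]) simp
    moreover have "singular_chain q (top_of_set (-(K \<inter> V i))) (cc j)" if "j \<in> I - {i}" for j
      using cc[of j] by (rule singular_chain_mono) (use disj that i in \<open>fastforce simp: disjoint_family_on_def\<close>)
    moreover have "singular_chain q (top_of_set (-(K \<inter> V i))) (part far)"
      using far by (rule singular_chain_mono) auto
    ultimately show ?thesis
      by (auto intro!: singular_chain_add singular_chain_sum)
  qed
  show thesis
  proof (rule that)
    fix i assume i: "i \<in> I"
    have "singular_chain (q-1) (top_of_set (-(K \<inter> V i))) (chain_boundary q c' - chain_boundary q (c' - cc i))"
      using c'(1) singular_chain_boundary[OF rest[OF i]]
      by (intro singular_chain_diff) (auto simp: singular_relcycle intro: singular_chain_mono)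
    then have "singular_chain (q-1) (top_of_set (-(K \<inter> V i))) (chain_boundary q (cc i))"
      by (simp add: chain_boundary_diff)
    moreover have "singular_chain (q-1) (top_of_set (V i)) (chain_boundary q (cc i))"
      using singular_chain_boundary[OF cc] by simp
    ultimately have "singular_chain (q-1) (top_of_set (V i - K)) (chain_boundary q (cc i))"
      unfolding singular_chain_subtopology by blast
    then show "singular_relcycle q (top_of_set (V i)) (V i - K) (cc i)"
      using cc[of i] by (simp add: singular_relcycle subtopology_subtopology Int_absorb1)
    have "homologous_rel q euclidean (-(K \<inter> V i)) c' (cc i)"
      unfolding homologous_rel_def by (rule singular_chain_imp_relboundary[OF rest[OF i]])
    moreover have "homologous_rel q euclidean (-(K \<inter> V i)) c c'"
      using c'(2) by (rule homologous_rel_mono) auto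
    ultimately show "homologous_rel q euclidean (-(K \<inter> V i)) c (cc i)"
      using homologous_rel_trans by blast
  next
    have "homologous_rel q euclidean (-K) c' (\<Sum>i\<in>I. cc i)"
      unfolding homologous_rel_def sum using singular_chain_imp_relboundary[OF far] by simp
    then show "homologous_rel q euclidean (-K) c (\<Sum>i\<in>I. cc i)"
      using c'(2) homologous_rel_trans by blast
  qed
qed

section \<open>A fibre permuted freely by a map of finite period\<close>

lemma dist_funpow_le:
  fixes F :: "'a::metric_space \<Rightarrow> 'a"
  assumes "\<And>x. dist (F x) x \<le> C"
  shows "dist ((F ^^ n) x) x \<le> real n * C"
proof (induction n)
  case (Suc n)
  have "dist ((F ^^ Suc n) x) x \<le> dist (F ((F ^^ n) x)) ((F ^^ n) x) + dist ((F ^^ n) x) x"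
    by (simp add: dist_triangle)
  also have "\<dots> \<le> C + real n * C"
    using assms Suc by (intro add_mono) auto
  finally show ?case by (simp add: algebra_simps)
qed auto

lemma continuous_on_funpow:
  fixes F :: "'a::topological_space \<Rightarrow> 'a"
  assumes "continuous_on UNIV F"
  shows "continuous_on UNIV (F ^^ n)"
proof (induction n)
  case (Suc n)
  then show ?case
    using assms continuous_on_compose[of UNIV "F ^^ n" F] continuous_on_subset by auto
qed (auto simp: id_def)

text \<open>The map \<open>h\<close> has degree 1, being at bounded distance from the identity. On the other hand let
  \<open>c\<close> be an indivisible cycle of the local homology at \<open>y\<close>, and let \<open>cc i\<close> be its part near the \<open>i\<close>-th
  piece of the fibre \<open>K\<close>. As \<open>F ^^ i\<close> also has bounded displacement, it carries the part
  \<open>cc 0\<close> to a chain homologous to \<open>cc i\<close>; and \<open>h\<close> does not distinguish the two because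
  \<open>h \<circ> F = h\<close>. So all \<open>p\<close> pieces contribute equally to the image of \<open>c\<close>, which is
  therefore divisible by \<open>p\<close>.\<close>

theorem freely_permuted_fibre_impossible:
  fixes F h :: "'a::euclidean_space \<Rightarrow> 'a"
  assumes p: "p \<ge> 2" and F: "continuous_on UNIV F" "F ^^ p = id" "\<And>x. dist (F x) x \<le> C"
    and h: "continuous_on UNIV h" "h \<circ> F = h" "\<And>x. dist (h x) x \<le> C"
    and E: "open E" "disjoint_family_on (\<lambda>i. (F ^^ i) ` E) {..<p}"
    and cover: "h -` {y} \<subseteq> (\<Union>i<p. (F ^^ i) ` E)"
  shows False
proof -
  define K where "K = h -` {y}"
  define V where "V i = (F ^^ i) ` E" for i
  \<comment> \<open>the fibre lies within \<open>C\<close> of \<open>y\<close>, and the iterates of \<open>F\<close> move points by at most \<open>p * C\<close>\<close>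
  define R where "R = 1 + C + p * C"
  let ?n = "DIM('a)"
  have C: "C \<ge> 0" using F(3) zero_le_dist order_trans by blast
  have hi: "h ((F ^^ i) x) = h x" for i x
    by (induction i) (use fun_cong[OF h(2)] in auto)
  have Fcont: "continuous_on UNIV (F ^^ i)" for i by (rule continuous_on_funpow[OF F(1)])
  have inv: "(F ^^ (p - i)) ((F ^^ i) x) = x" "(F ^^ i) ((F ^^ (p - i)) x) = x" if "i \<le> p" for i x
    using that F(2) by (simp_all add: funpow_add[symmetric, THEN fun_cong, unfolded o_def])
  have disp: "dist ((F ^^ i) x) x \<le> p * C" if "i < p" for i x
  proof -
    have "dist ((F ^^ i) x) x \<le> i * C" using dist_funpow_le[of F C] F(3) by blast
    also have "\<dots> \<le> p * C" using that C by (intro mult_right_mono) auto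
    finally show ?thesis .
  qed
  have V0: "V 0 = E" by (simp add: V_def)
  have V_alt: "V i = (F ^^ (p - i)) -` E" if "i < p" for i
  proof (intro Set.set_eqI iffI)
    fix x assume "x \<in> (F ^^ (p - i)) -` E"
    then have "(F ^^ i) ((F ^^ (p - i)) x) \<in> V i" unfolding V_def by blast
    then show "x \<in> V i" using inv[of i] that by simp
  qed (use inv[of i] that in \<open>auto simp: V_def\<close>)
  have Vopen: "open (V i)" if "i < p" for i
    unfolding V_alt[OF that] using Fcont E(1) by (simp add: open_vimage)
  have Kclosed: "closed K"
    unfolding K_def using h(1) by (simp add: continuous_closed_vimage continuous_on_eq_continuous_within)
  have Kdisp: "dist y x \<le> C" if "x \<in> K" for x
    using h(3)[of x] that by (auto simp: K_def)
  have Kinv: "(F ^^ i) x \<in> K \<longleftrightarrow> x \<in> K" for i x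
    by (simp add: K_def hi)
  obtain c0 where c0: "singular_relcycle ?n euclidean (-{y}) c0"
    and indiv: "\<And>d. singular_relcycle ?n euclidean (-{y}) d
      \<Longrightarrow> \<not> homologous_rel ?n euclidean (-{y}) c0 (frag_cmul (int p) d)"
    using indivisible_relcycle_exists[OF p] by metis
  obtain c where c: "singular_relcycle ?n euclidean (- ball y R) c"
    and c0c: "homologous_rel ?n euclidean (-{y}) c0 c"
    using relcycle_spread[OF c0] by metis
  have cchain: "chain_map ?n id c = c"
    using c chain_map_ident by (auto simp: singular_relcycle)
  have KR: "-ball y R \<subseteq> -K"
  proof (rule subsetI)
    fix x assume "x \<in> - ball y R"
    moreover have "real p * C \<ge> 0" using C by simp
    ultimately have "dist y x > C" by (simp add: R_def not_less)
    then show "x \<in> -K" using Kdisp[of x] by auto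
  qed
  have cK: "singular_relcycle ?n euclidean (-K) c"
    using c KR singular_relcycle_mono by blast
  have move: "homologous_rel ?n euclidean T (chain_map ?n g c) c"
    if g: "continuous_on UNIV g" "\<And>x. dist (g x) x \<le> D" and D: "-T \<subseteq> ball y (R - D)" for g D T
  proof -
    have "homologous_rel ?n euclidean T (chain_map ?n g c) (chain_map ?n id c)"
    proof (rule homologous_rel_straight_line[OF g(1) _ _ c])
      fix x assume x: "x \<in> - ball y R"
      show "closed_segment (g x) (id x) \<subseteq> T"
      proof
        fix z assume "z \<in> closed_segment (g x) (id x)"
        then have "dist z x \<le> dist (g x) x" using dist_in_closed_segment[of z "g x" x] by (auto simp: dist_commute)
        then have "dist z x \<le> D" using g(2)[of x] by linarith
        moreover have "dist y x \<le> dist y z + dist z x" by (rule dist_triangle)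
        ultimately have "z \<notin> ball y (R - D)" using x by auto
        then show "z \<in> T" using D by auto
      qed
    qed auto
    then show ?thesis by (simp only: cchain)
  qed
  have Vdisj: "disjoint_family_on V {..<p}" and Kcover: "K \<subseteq> (\<Union>i<p. V i)"
    using E(2) cover by (simp_all add: V_def K_def disjoint_family_on_def)
  obtain cc where ccy: "\<And>i. i < p \<Longrightarrow> singular_relcycle ?n (top_of_set (V i)) (V i - K) (cc i)"
    and cch: "\<And>i. i < p \<Longrightarrow> homologous_rel ?n euclidean (-(K \<inter> V i)) c (cc i)"
    and ccsum: "homologous_rel ?n euclidean (-K) c (\<Sum>i<p. cc i)"
    by (rule relcycle_decomposition[OF _ _ Vdisj Kclosed Kcover cK]) (use Vopen in auto)
  have hmap: "continuous_map euclidean euclidean h" "h \<in> -K \<rightarrow> -{y}"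
    using h(1) by (auto simp: K_def)
  have piece: "homologous_rel ?n euclidean (-{y}) (chain_map ?n h (cc i)) (chain_map ?n h (cc 0))" if i: "i < p" for i
  proof -
    let ?a = "chain_map ?n (F ^^ i) (cc 0)"
    have contV: "continuous_map (top_of_set (V 0)) (top_of_set (V i)) (F ^^ i)"
      using continuous_on_subset[OF Fcont] by (auto simp: V_def)
    have 1: "singular_relcycle ?n (top_of_set (V i)) (V i - (K \<inter> V i)) ?a"
      by (rule singular_relcycle_chain_map[OF ccy contV])
         (use p Kinv in \<open>auto simp: V_def\<close>)
    have 2: "singular_relcycle ?n (top_of_set (V i)) (V i - (K \<inter> V i)) (cc i)"
      using ccy[OF i] by (simp add: Diff_Int)
    have "homologous_rel ?n euclidean (-(K \<inter> V i)) (chain_map ?n (F ^^ i) c) ?a"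
    proof (rule homologous_rel_chain_map[OF cch])
      show "F ^^ i \<in> - (K \<inter> V 0) \<rightarrow> - (K \<inter> V i)"
      proof
        fix x assume x: "x \<in> - (K \<inter> V 0)"
        have "x \<in> E" if "(F ^^ i) x \<in> V i"
          using that V_alt[OF i] inv[of i x] i by auto
        then show "(F ^^ i) x \<in> - (K \<inter> V i)"
          using x Kinv by (auto simp: V0)
      qed
    qed (use p Fcont in auto)
    moreover have "homologous_rel ?n euclidean (-(K \<inter> V i)) (chain_map ?n (F ^^ i) c) c"
    proof (rule move[OF Fcont disp[OF i]])
      show "- (- (K \<inter> V i)) \<subseteq> ball y (R - p * C)"
        using Kdisp by (fastforce simp: R_def)
    qed
    ultimately have "homologous_rel ?n euclidean (-(K \<inter> V i)) ?a (cc i)"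
      using cch[OF i] by (meson homologous_rel_sym homologous_rel_trans)
    moreover have "closed (K \<inter> V i)"
    proof -
      have "K \<inter> V i = K - (\<Union>j\<in>{..<p}-{i}. V j)"
      proof -
        have "V i \<inter> V j = {}" if "j \<in> {..<p} - {i}" for j
          using Vdisj i that by (auto simp: disjoint_family_on_def)
        then show ?thesis using Kcover by blast
      qed
      then show ?thesis using Kclosed Vopen by (auto intro!: closed_Diff)
    qed
    ultimately have "homologous_rel ?n (top_of_set (V i)) (V i - (K \<inter> V i)) ?a (cc i)"
      using homologous_rel_excision[OF Vopen[OF i] _ _ 1 2] by auto
    then have "homologous_rel ?n euclidean (-{y}) (chain_map ?n h ?a) (chain_map ?n h (cc i))"
      by (rule homologous_rel_chain_map) (use hmap in \<open>auto intro: continuous_on_subset\<close>)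
    moreover have "chain_map ?n h ?a = chain_map ?n h (cc 0)"
    proof -
      have "h \<circ> (F ^^ i) = h" using hi by auto
      then show ?thesis by (metis chain_map_compose comp_apply)
    qed
    ultimately show ?thesis by (simp add: homologous_rel_sym)
  qed
  have "homologous_rel ?n euclidean (-{y}) c (chain_map ?n h c)"
  proof (subst homologous_rel_sym, rule move[OF h(1,3)])
    show "- (-{y}) \<subseteq> ball y (R - C)" using C by (simp add: R_def add_pos_nonneg)
  qed
  moreover have "homologous_rel ?n euclidean (-{y}) (chain_map ?n h c) (\<Sum>i<p. chain_map ?n h (cc i))"
    using homologous_rel_chain_map[OF ccsum hmap] by (simp add: chain_map_sum o_def)
  moreover have "homologous_rel ?n euclidean (-{y}) (\<Sum>i<p. chain_map ?n h (cc i)) (\<Sum>i<p. chain_map ?n h (cc 0))"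
    by (rule homologous_rel_sum) (use piece in auto)
  moreover have "(\<Sum>i<m. chain_map ?n h (cc 0)) = frag_cmul (int m) (chain_map ?n h (cc 0))" for m
    by (induction m) (auto simp: frag_cmul_distrib add.commute)
  ultimately have "homologous_rel ?n euclidean (-{y}) c0 (frag_cmul (int p) (chain_map ?n h (cc 0)))"
    using c0c by (metis homologous_rel_trans)
  moreover have "singular_relcycle ?n euclidean (-{y}) (chain_map ?n h (cc 0))"
    by (rule singular_relcycle_chain_map[OF ccy]) (use p hmap in \<open>auto intro: continuous_on_subset\<close>)
  ultimately show False using indiv by blast
qed

section \<open>Periodic maps with bounded displacement\<close>

text \<open>Sums over the orbit are invariant. This serves twice: for the average of the iterates of \<open>F\<close>,
  and for making perturbations invariant.\<close>

lemma cyclic_sum_shift: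
  assumes "F ^^ p = id"
  shows "(\<Sum>i<p. v ((F ^^ i) (F x))) = (\<Sum>i<p. v ((F ^^ i) x) :: 'b::ab_group_add)"
proof -
  have "v x + (\<Sum>i<p. v ((F ^^ i) (F x))) = (\<Sum>i<Suc p. v ((F ^^ i) x))"
    by (subst sum.lessThan_Suc_shift) (simp add: funpow_swap1)
  also have "\<dots> = v x + (\<Sum>i<p. v ((F ^^ i) x))"
    using assms by simp
  finally show ?thesis by simp
qed

text \<open>On \<open>S\<close> the map \<open>h\<close> is replaced by a polynomial map plus a small constant, which misses \<open>y\<close>
  there because a differentiable image of a negligible set is negligible. The correction is
  extended from \<open>S\<close> by Tietze's theorem so as to vanish on the other iterates of \<open>S\<close>.
  Summing it over orbits then gives an invariant correction with the same values on \<open>S\<close>.\<close>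

lemma perturb_off_orbit:
  fixes F h :: "'a::euclidean_space \<Rightarrow> 'a"
  assumes F: "continuous_on UNIV F" "F ^^ p = id" and p: "p > 0"
    and h: "continuous_on UNIV h" "h \<circ> F = h"
    and S: "compact S" "negligible S" "disjoint_family_on (\<lambda>i. (F ^^ i) ` S) {..<p}"
    and \<eta>: "\<eta> > 0"
  obtains h' where "continuous_on UNIV h'" "h' \<circ> F = h'" "\<And>x. dist (h' x) (h x) < \<eta>" "y \<notin> h' ` S"
proof -
  \<comment> \<open>the correction is summed over an orbit of length \<open>p\<close>, which multiplies its size by \<open>p\<close>\<close>
  define \<epsilon> where "\<epsilon> = \<eta> / (2 * p)"
  have \<epsilon>: "\<epsilon> > 0" "p * \<epsilon> < \<eta>" using \<eta> p by (simp_all add: \<epsilon>_def)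
  have hS: "continuous_on S h" using h(1) continuous_on_subset by blast
  obtain g where g: "polynomial_function g" "\<And>x. x \<in> S \<Longrightarrow> norm (h x - g x) < \<epsilon> / 2"
    using Stone_Weierstrass_polynomial_function[OF S(1) hS, of "\<epsilon> / 2"] \<epsilon> by auto
  have "negligible (g ` S)"
    by (rule negligible_differentiable_image_negligible[OF order_refl S(2)])
       (simp add: differentiable_on_polynomial_function g(1))
  moreover have "\<not> negligible (ball y (\<epsilon> / 2))"
    using \<epsilon> by (intro open_not_negligible) auto
  ultimately obtain z where z: "z \<in> ball y (\<epsilon> / 2)" "z \<notin> g ` S"
    using negligible_subset by blast
  \<comment> \<open>adding \<open>u\<close> to \<open>h\<close> gives \<open>g\<close> translated by \<open>y - z\<close>, which hits \<open>y\<close> only where \<open>g\<close> hits \<open>z\<close>\<close>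
  define u where "u x = g x + (y - z) - h x" for x
  have u: "norm (u x) \<le> \<epsilon>" if "x \<in> S" for x
  proof -
    have "norm (u x) \<le> norm (y - z) + norm (h x - g x)"
      unfolding u_def using norm_triangle_ineq4[of "y - z" "h x - g x"] by (simp add: algebra_simps)
    also have "\<dots> \<le> \<epsilon>" using g(2)[OF that] z(1) by (simp add: dist_norm)
    finally show ?thesis .
  qed
  define S' where "S' = (\<Union>i\<in>{0<..<p}. (F ^^ i) ` S)"
  have Fcont: "continuous_on T (F ^^ i)" for i T
    using continuous_on_funpow[OF F(1)] continuous_on_subset by blast
  have "compact S'" unfolding S'_def by (intro compact_UN compact_continuous_image Fcont S) auto
  then have S': "closed S'" by (rule compact_imp_closed)
  have dis: "(F ^^ i) x \<notin> S" if "x \<in> S" "0 < i" "i < p" for i x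
    using disjoint_family_onD[OF S(3), of 0 i] that by auto
  have "continuous_on (S \<union> S') (\<lambda>x. if x \<in> S then u x else 0)"
  proof (rule continuous_on_cases)
    show "closed S" using S(1) by (rule compact_imp_closed)
    show "continuous_on S u"
      unfolding u_def using g(1) hS by (intro continuous_intros) (auto intro: continuous_on_polymonial_function)
    show "\<forall>x. x \<in> S \<and> x \<notin> S \<or> x \<in> S' \<and> x \<in> S \<longrightarrow> u x = 0"
      using dis by (auto simp: S'_def)
  qed (use S' in auto)
  then obtain v where v: "continuous_on UNIV v" "\<And>x. x \<in> S \<union> S' \<Longrightarrow> v x = (if x \<in> S then u x else 0)"
    "\<And>x. x \<in> UNIV \<Longrightarrow> norm (v x) \<le> \<epsilon>"
  proof (rule Tietze[where B=\<epsilon>])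
    show "closedin (top_of_set UNIV) (S \<union> S')"
      using S' compact_imp_closed[OF S(1)] by (simp add: closed_Un)
  qed (use u \<epsilon> in auto)
  define h' where "h' x = h x + (\<Sum>i<p. v ((F ^^ i) x))" for x
  show thesis
  proof (rule that)
    show "continuous_on UNIV h'"
      unfolding h'_def by (intro continuous_intros h(1) continuous_on_compose2[OF v(1)] Fcont) auto
    show "h' \<circ> F = h'"
      using fun_cong[OF h(2)] by (auto simp: h'_def fun_eq_iff cyclic_sum_shift[OF F(2)])
    show "dist (h' x) (h x) < \<eta>" for x
    proof -
      have "dist (h' x) (h x) \<le> (\<Sum>i<p. \<epsilon>)"
        unfolding h'_def dist_norm add_diff_cancel_left' using v(3) by (intro sum_norm_le) auto
      then show ?thesis using \<epsilon> by simp
    qed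
    show "y \<notin> h' ` S"
    proof
      assume "y \<in> h' ` S"
      then obtain s where s: "s \<in> S" "y = h' s" by auto
      have "(\<Sum>i<p. v ((F ^^ i) s)) = (\<Sum>i<p. if i = 0 then u s else 0)"
      proof (rule sum.cong)
        fix i assume i: "i \<in> {..<p}"
        show "v ((F ^^ i) s) = (if i = 0 then u s else 0)"
        proof (cases "i = 0")
          case False
          then have "(F ^^ i) s \<in> S'" using s i by (auto simp: S'_def)
          then show ?thesis using False dis[OF s(1), of i] i v(2) by auto
        qed (use s v(2) in auto)
      qed auto
      then have "y = g s + (y - z)" using s p by (simp add: h'_def u_def)
      then show False using z s by auto
    qed
  qed
qed

text \<open>One set at a time: on the sets treated before, the map has a positive distance to \<open>y\<close>, and the
  next perturbation is chosen smaller than this distance.\<close>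

lemma perturb_off_orbits:
  fixes F h :: "'a::euclidean_space \<Rightarrow> 'a"
  assumes F: "continuous_on UNIV F" "F ^^ p = id" and p: "p > 0"
    and h: "continuous_on UNIV h" "h \<circ> F = h"
    and fin: "finite \<S>"
    and S: "\<And>S. S \<in> \<S> \<Longrightarrow> compact S \<and> negligible S \<and> disjoint_family_on (\<lambda>i. (F ^^ i) ` S) {..<p}"
    and \<eta>: "\<eta> > 0"
  shows "\<exists>h'. continuous_on UNIV h' \<and> h' \<circ> F = h' \<and> (\<forall>x. dist (h' x) (h x) < \<eta>) \<and> y \<notin> h' ` \<Union>\<S>"
  using fin S \<eta>
proof (induction arbitrary: \<eta>)
  case empty
  then show ?case using h by (intro exI[of _ h]) auto
next
  case (insert S \<S>)
  then obtain h1 where h1: "continuous_on UNIV h1" "h1 \<circ> F = h1" "\<And>x. dist (h1 x) (h x) < \<eta> / 2" "y \<notin> h1 ` \<Union>\<S>"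
    by (metis half_gt_zero insertCI)
  have "compact (\<Union>\<S>)" using insert by (intro compact_Union) auto
  then have "closed (h1 ` \<Union>\<S>)"
    using h1(1) by (intro compact_imp_closed compact_continuous_image) (auto intro: continuous_on_subset)
  then obtain \<delta> where \<delta>: "\<delta> > 0" "\<And>x. x \<in> h1 ` \<Union>\<S> \<Longrightarrow> \<delta> \<le> dist y x"
    using separate_point_closed[of "h1 ` \<Union>\<S>" y] h1(4) by blast
  obtain h2 where h2: "continuous_on UNIV h2" "h2 \<circ> F = h2" "\<And>x. dist (h2 x) (h1 x) < min \<delta> (\<eta> / 2)" "y \<notin> h2 ` S"
    using perturb_off_orbit[OF F p h1(1,2), where S=S and \<eta>="min \<delta> (\<eta> / 2)" and y=y] insert.prems \<delta>(1) by (metis half_gt_zero insertI1 min_less_iff_conj)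
  have "dist (h2 x) (h x) < \<eta>" for x
    using h2(3)[of x] h1(3)[of x] dist_triangle[of "h2 x" "h x" "h1 x"] by simp
  moreover have "y \<notin> h2 ` \<Union>\<S>"
  proof
    assume "y \<in> h2 ` \<Union>\<S>"
    then obtain x where x: "x \<in> \<Union>\<S>" "y = h2 x" by auto
    then show False using \<delta>(2)[of "h1 x"] h2(3)[of x] by auto
  qed
  ultimately show ?case using h2 by (intro exI[of _ h2]) auto
qed

text \<open>If two of the iterates agree at \<open>x\<close>, some \<open>F ^^ a\<close> with \<open>a\<close> prime to \<open>p\<close> fixes \<open>x\<close>, and a
  Bezout relation between \<open>a\<close> and \<open>p\<close> shows that \<open>F\<close> fixes \<open>x\<close>.\<close>

lemma prime_period_moves_distinctly:
  assumes "prime p" "F ^^ p = id" "F x \<noteq> x" "i < p" "j < p" "(F ^^ i) x = (F ^^ j) x"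
  shows "i = j"
proof -
  have fixes_mult: "(F ^^ (a * u)) x = x" if "(F ^^ a) x = x" for a u
    by (induction u) (use that in \<open>auto simp: funpow_add\<close>)
  have False if ij: "i < j" "j < p" "(F ^^ i) x = (F ^^ j) x" for i j
  proof -
    have "(F ^^ (p - i)) ((F ^^ i) x) = x" for x
      using assms(2) ij by (simp add: funpow_add[symmetric, THEN fun_cong, unfolded o_def])
    moreover have "(F ^^ j) x = (F ^^ i) ((F ^^ (j - i)) x)"
      using ij by (simp add: funpow_add[symmetric, THEN fun_cong, unfolded o_def])
    ultimately have fx: "(F ^^ (j - i)) x = x"
      using ij(3) by metis
    have "coprime (j - i) p"
      using assms(1) ij by (metis coprime_commute diff_le_self dvd_imp_le le_less_trans linorder_not_le prime_imp_coprime zero_less_diff)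
    then obtain u v where "(j - i) * u = p * v + 1"
      using bezout_nat[of "j - i" p] ij by (auto simp: coprime_iff_gcd_eq_1)
    then have "(F ^^ (p * v + 1)) x = x" using fixes_mult[OF fx, of u] by simp
    moreover have "(F ^^ (p * v + 1)) x = F x"
      using fixes_mult[of p "v"] assms(2) by (simp add: funpow_add)
    ultimately show False using assms(3) by simp
  qed
  then show ?thesis using assms(4-6) by (metis nat_neq_iff)
qed

lemma orbit_disjoint_cball:
  fixes F :: "'a::metric_space \<Rightarrow> 'a"
  assumes F: "continuous_on UNIV F" and inj: "inj_on (\<lambda>i. (F ^^ i) x) {..<p}"
  obtains r where "r > 0" "disjoint_family_on (\<lambda>i. (F ^^ i) ` cball x r) {..<p}"
proof -
  define D where "D = insert 1 ((\<lambda>(i, j). dist ((F ^^ i) x) ((F ^^ j) x)) ` {(i, j). i < p \<and> j < p \<and> i \<noteq> j})"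
  have "{(i, j). i < p \<and> j < p \<and> i \<noteq> j} \<subseteq> {..<p} \<times> {..<p}" by auto
  then have D: "finite D" "D \<noteq> {}" unfolding D_def by (auto intro!: finite_imageI dest: finite_subset)
  have pos: "Min D > 0"
    using D inj by (subst Min_gr_iff) (auto simp: D_def inj_on_def)
  have sep: "Min D \<le> dist ((F ^^ i) x) ((F ^^ j) x)" if "i < p" "j < p" "i \<noteq> j" for i j
    using that D by (intro Min_le) (auto simp: D_def)
  have "eventually (\<lambda>z. dist ((F ^^ i) z) ((F ^^ i) x) < Min D / 2) (nhds x)" for i
  proof -
    have "((F ^^ i) \<longlongrightarrow> (F ^^ i) x) (nhds x)"
      using continuous_on_funpow[OF F, of i] by (simp add: continuous_on_eq_continuous_at isCont_def tendsto_at_iff_tendsto_nhds)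
    then show ?thesis using pos by (intro tendstoD) auto
  qed
  then have "eventually (\<lambda>z. \<forall>i\<in>{..<p}. dist ((F ^^ i) z) ((F ^^ i) x) < Min D / 2) (nhds x)"
    by (intro eventually_ball_finite) auto
  then obtain d where d: "d > 0" "\<And>z i. dist z x < d \<Longrightarrow> i < p \<Longrightarrow> dist ((F ^^ i) z) ((F ^^ i) x) < Min D / 2"
    unfolding eventually_nhds_metric by blast
  show thesis
  proof (rule that[of "d / 2"])
    show "disjoint_family_on (\<lambda>i. (F ^^ i) ` cball x (d / 2)) {..<p}"
      unfolding disjoint_family_on_def
    proof (intro ballI impI equals0I)
      fix i j a assume ij: "i \<in> {..<p}" "j \<in> {..<p}" "i \<noteq> j"
        and a: "a \<in> (F ^^ i) ` cball x (d / 2) \<inter> (F ^^ j) ` cball x (d / 2)"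
      then have "dist a ((F ^^ i) x) < Min D / 2" "dist a ((F ^^ j) x) < Min D / 2"
      proof -
        have near: "dist ((F ^^ k) z) ((F ^^ k) x) < Min D / 2" if "z \<in> cball x (d / 2)" "k < p" for z k
          using that d(1) by (intro d(2)) (auto simp: dist_commute)
        obtain z w where "z \<in> cball x (d / 2)" "w \<in> cball x (d / 2)" "a = (F ^^ i) z" "a = (F ^^ j) w"
          using a by blast
        then show "dist a ((F ^^ i) x) < Min D / 2" "dist a ((F ^^ j) x) < Min D / 2"
          using near[of z i] near[of w j] ij by auto
      qed
      then have "dist ((F ^^ i) x) ((F ^^ j) x) < Min D"
        by (metis dist_triangle_half_r)
      then show False using sep[of i j] ij by auto
    qed
  qed (use d in simp)
qed

text \<open>The fibre of the averaged map \<open>h0\<close> over a moved point \<open>y\<close> is compact and has no fixed points. It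
  is covered by finitely many balls whose iterates are disjoint, and \<open>h\<close> is an invariant
  perturbation of \<open>h0\<close> that misses \<open>y\<close> on all the bounding spheres. Numbering the balls and
  removing from each the closed orbits of its predecessors yields an open set \<open>E\<close> whose iterates are
  disjoint. They still cover the fibre of \<open>h\<close>, since what is lost lies on the spheres.\<close>

theorem bounded_displacement_prime_period:
  fixes F :: "'a::euclidean_space \<Rightarrow> 'a"
  assumes p: "prime p" and F: "continuous_on UNIV F" "F ^^ p = id" "\<And>x. dist (F x) x \<le> C"
  shows "F = id"
proof (rule ccontr)
  assume "F \<noteq> id"
  then obtain y where y: "F y \<noteq> y" by (auto simp: fun_eq_iff)
  have p2: "p \<ge> 2" and p0: "p > 0" using p prime_ge_2_nat prime_gt_0_nat by auto
  have C: "C \<ge> 0" using F(3) zero_le_dist order_trans by blast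
  have Fcont: "continuous_on T (F ^^ i)" for i T
    using continuous_on_funpow[OF F(1)] continuous_on_subset by blast
  have per: "(F ^^ (p * k)) x = x" for k x
    using F(2) by (simp add: funpow_mult[symmetric] id_funpow)
  have unwind: "(F ^^ (p * k - k)) ((F ^^ k) x) = x" for k x
  proof -
    have "p * k - k + k = p * k" using p0 by (cases p) auto
    then show ?thesis using per[of k x] by (metis comp_apply funpow_add)
  qed
  have modp: "(F ^^ (k mod p)) x = (F ^^ k) x" for k x
    by (rule funpow_mod_eq) (simp add: F(2))
  define h0 where "h0 x = (1 / real p) *\<^sub>R (\<Sum>i<p. (F ^^ i) x)" for x
  have h0cont: "continuous_on UNIV h0"
    unfolding h0_def by (intro continuous_intros Fcont)
  have h0F: "h0 \<circ> F = h0"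
    using cyclic_sum_shift[OF F(2), of "\<lambda>x. x"] by (auto simp: h0_def fun_eq_iff)
  have h0disp: "dist (h0 x) x \<le> p * C" for x
  proof -
    have "h0 x - x = (1 / real p) *\<^sub>R (\<Sum>i<p. (F ^^ i) x - x)"
      using p0 by (simp add: h0_def sum_subtractf scaleR_diff_right scaleR_conv_of_real[of "real p", symmetric] real_vector.scale_scale sum_constant_scaleR)
    moreover have "norm (\<Sum>i<p. (F ^^ i) x - x) \<le> (\<Sum>i<p. p * C)"
    proof (rule sum_norm_le)
      fix i assume i: "i \<in> {..<p}"
      have "norm ((F ^^ i) x - x) \<le> i * C"
        using dist_funpow_le[of F C i x] F(3) by (simp add: dist_norm)
      also have "\<dots> \<le> p * C" using i C by (intro mult_right_mono) auto
      finally show "norm ((F ^^ i) x - x) \<le> p * C" .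
    qed
    ultimately show ?thesis using p0 by (simp add: dist_norm field_simps)
  qed
  define K where "K = h0 -` {y}"
  \<comment> \<open>at a fixed point of \<open>F\<close> the average \<open>h0\<close> is that point itself, which would then be \<open>y\<close>\<close>
  have Kmoved: "F x \<noteq> x" if "x \<in> K" for x
  proof
    assume "F x = x"
    then have "(F ^^ i) x = x" for i by (induction i) auto
    then have "h0 x = x" using p0 by (simp add: h0_def sum_constant_scaleR)
    then show False using \<open>F x = x\<close> that y by (simp add: K_def)
  qed
  have "\<exists>r>0. disjoint_family_on (\<lambda>i. (F ^^ i) ` cball x r) {..<p}" if "x \<in> K" for x
  proof -
    have "inj_on (\<lambda>i. (F ^^ i) x) {..<p}"
      using prime_period_moves_distinctly[OF p F(2) Kmoved[OF that]] by (auto intro: inj_onI)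
    from orbit_disjoint_cball[OF F(1) this] show ?thesis by blast
  qed
  then obtain r where r: "\<And>x. x \<in> K \<Longrightarrow> r x > 0"
    "\<And>x. x \<in> K \<Longrightarrow> disjoint_family_on (\<lambda>i. (F ^^ i) ` cball x (r x)) {..<p}"
    by metis
  have "closed K"
    unfolding K_def using h0cont by (simp add: continuous_closed_vimage continuous_on_eq_continuous_within)
  moreover have "K \<subseteq> cball y (p * C)"
    using h0disp by (auto simp: K_def)
  ultimately have Kcomp: "compact K"
    by (meson bounded_cball bounded_subset compact_eq_bounded_closed)
  obtain X where X: "X \<subseteq> K" "finite X" "K \<subseteq> (\<Union>x\<in>X. ball x (r x))"
  proof (rule compactE_image[OF Kcomp, of K "\<lambda>x. ball x (r x)"])
    show "K \<subseteq> (\<Union>x\<in>K. ball x (r x))" using r(1) by force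
  qed auto
  \<comment> \<open>the union of all iterates of \<open>S\<close>, written with preimages\<close>
  define sat where "sat S = {a. \<exists>k. (F ^^ k) a \<in> S}" for S
  have sat_eq: "sat S = (\<Union>k<p. (F ^^ k) -` S)" for S
  proof
    show "sat S \<subseteq> (\<Union>k<p. (F ^^ k) -` S)"
    proof
      fix a assume "a \<in> sat S"
      then obtain k where "(F ^^ k) a \<in> S" by (auto simp: sat_def)
      then have "a \<in> (F ^^ (k mod p)) -` S" by (simp add: modp)
      then show "a \<in> (\<Union>k<p. (F ^^ k) -` S)" using p0 by (intro UN_I[of "k mod p"]) auto
    qed
  qed (auto simp: sat_def)
  have sat_inv: "(F ^^ k) a \<in> sat S \<longleftrightarrow> a \<in> sat S" for k a S
  proof
    assume "a \<in> sat S"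
    then obtain m where "(F ^^ m) a \<in> S" by (auto simp: sat_def)
    then have "(F ^^ (m + (p * k - k))) ((F ^^ k) a) \<in> S"
      using unwind by (simp add: funpow_add)
    then show "(F ^^ k) a \<in> sat S" unfolding sat_def by blast
  next
    assume "(F ^^ k) a \<in> sat S"
    then obtain m where "(F ^^ m) ((F ^^ k) a) \<in> S" by (auto simp: sat_def)
    then have "(F ^^ (m + k)) a \<in> S" by (simp add: funpow_add)
    then show "a \<in> sat S" unfolding sat_def by blast
  qed
  have sat_closed: "closed (sat S)" if "closed S" for S
    unfolding sat_eq using that Fcont
    by (intro closed_UN) (auto intro!: continuous_closed_vimage simp: continuous_on_eq_continuous_within)
  define U where "U = (\<Union>x\<in>X. ball x (r x))"
  have "\<exists>\<epsilon>>0. \<epsilon> \<le> 1 \<and> (\<forall>x. dist (h0 x) y < \<epsilon> \<longrightarrow> x \<in> U)"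
  proof -
    define L where "L = cball y (p * C + 1) - U"
    have "compact L" unfolding L_def U_def by (intro compact_diff) auto
    then have "closed (h0 ` L)"
      using h0cont by (intro compact_imp_closed compact_continuous_image) (auto intro: continuous_on_subset)
    moreover have "y \<notin> h0 ` L" using X(3) by (auto simp: L_def K_def U_def)
    ultimately obtain \<delta> where \<delta>: "\<delta> > 0" "\<And>x. x \<in> h0 ` L \<Longrightarrow> \<delta> \<le> dist y x"
      using separate_point_closed[of "h0 ` L" y] by blast
    show ?thesis
    proof (intro exI[of _ "min \<delta> 1"] conjI allI impI)
      fix x assume x: "dist (h0 x) y < min \<delta> 1"
      then have "x \<notin> L" using \<delta>(2)[of "h0 x"] by (auto simp: dist_commute)
      moreover have "dist y x \<le> p * C + 1"
        using h0disp[of x] x dist_triangle[of y x "h0 x"] by (simp add: dist_commute)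
      ultimately show "x \<in> U" by (auto simp: L_def)
    qed (use \<delta> in auto)
  qed
  then obtain \<epsilon> where \<epsilon>: "\<epsilon> > 0" "\<epsilon> \<le> 1" "\<And>x. dist (h0 x) y < \<epsilon> \<Longrightarrow> x \<in> U" by blast
  have "\<exists>h. continuous_on UNIV h \<and> h \<circ> F = h \<and> (\<forall>x. dist (h x) (h0 x) < \<epsilon>) \<and> y \<notin> h ` \<Union>((\<lambda>x. sphere x (r x)) ` X)"
  proof (rule perturb_off_orbits[OF F(1,2) p0 h0cont h0F _ _ \<epsilon>(1)])
    fix S assume "S \<in> (\<lambda>x. sphere x (r x)) ` X"
    then obtain x where x: "x \<in> X" "S = sphere x (r x)" by blast
    moreover have "disjoint_family_on (\<lambda>i. (F ^^ i) ` sphere x (r x)) {..<p}"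
      unfolding disjoint_family_on_def
    proof (intro ballI impI)
      fix i j assume ij: "i \<in> {..<p}" "j \<in> {..<p}" "i \<noteq> j"
      have "(F ^^ i) ` sphere x (r x) \<inter> (F ^^ j) ` sphere x (r x)
          \<subseteq> (F ^^ i) ` cball x (r x) \<inter> (F ^^ j) ` cball x (r x)"
        by (intro Int_mono image_mono sphere_cball)
      then show "(F ^^ i) ` sphere x (r x) \<inter> (F ^^ j) ` sphere x (r x) = {}"
        using disjoint_family_onD[OF r(2) ij] x X(1) by blast
    qed
    ultimately show "compact S \<and> negligible S \<and> disjoint_family_on (\<lambda>i. (F ^^ i) ` S) {..<p}"
      by (auto intro: negligible_sphere)
  qed (use X in auto)
  then obtain h where h: "continuous_on UNIV h" "h \<circ> F = h" "\<And>x. dist (h x) (h0 x) < \<epsilon>"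
    and hS: "\<And>x z. x \<in> X \<Longrightarrow> z \<in> sphere x (r x) \<Longrightarrow> h z \<noteq> y" by blast
  have hk: "h ((F ^^ k) x) = h x" for k x
    by (induction k) (use fun_cong[OF h(2)] in auto)
  obtain e :: "'a \<Rightarrow> nat" where e: "inj_on e X"
    using finite_imp_inj_to_nat_seg[OF X(2)] by blast
  define E where "E = (\<Union>x\<in>X. ball x (r x) - (\<Union>z\<in>{z\<in>X. e z < e x}. sat (cball z (r z))))"
  show False
  proof (rule freely_permuted_fibre_impossible[OF p2 F(1,2) _ h(1,2)])
    show "dist (F x) x \<le> 1 + p * C" for x
      using F(3)[of x] C p0 mult_right_mono[of 1 "real p" C] by simp
    show "dist (h x) x \<le> 1 + p * C" for x
      using dist_triangle[of "h x" x "h0 x"] h(3)[of x] h0disp[of x] \<epsilon>(2) by simp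
    show "open E"
      unfolding E_def using X(2) sat_closed by (intro open_UN ballI open_Diff closed_UN) auto
    show "disjoint_family_on (\<lambda>i. (F ^^ i) ` E) {..<p}"
      unfolding disjoint_family_on_def
    proof (intro ballI impI equals0I)
      fix i j a assume ij: "i \<in> {..<p}" "j \<in> {..<p}" "i \<noteq> j" and a: "a \<in> (F ^^ i) ` E \<inter> (F ^^ j) ` E"
      obtain b b' where b: "a = (F ^^ i) b" "b \<in> E" "a = (F ^^ j) b'" "b' \<in> E" using a by blast
      have sat_bb: "b \<in> sat S \<longleftrightarrow> b' \<in> sat S" for S using sat_inv b by metis
      obtain x where x: "x \<in> X" "b \<in> ball x (r x)" "\<And>z. z \<in> X \<Longrightarrow> e z < e x \<Longrightarrow> b \<notin> sat (cball z (r z))"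
        using b(2) by (auto simp: E_def)
      obtain x' where x': "x' \<in> X" "b' \<in> ball x' (r x')" "\<And>z. z \<in> X \<Longrightarrow> e z < e x' \<Longrightarrow> b' \<notin> sat (cball z (r z))"
        using b(4) by (auto simp: E_def)
      have in_sat: "c \<in> sat (cball z (r z))" if "c \<in> ball z (r z)" for c z
      proof -
        have "(F ^^ 0) c \<in> cball z (r z)" using that by simp
        then show ?thesis unfolding sat_def by blast
      qed
      have "e x = e x'"
        using x x' sat_bb in_sat by (meson linorder_neqE_nat)
      then have "x = x'" using e x x' by (auto dest: inj_onD)
      moreover have "a \<in> (F ^^ i) ` cball x (r x)"
        unfolding b(1) using x(2) by (intro imageI) auto
      moreover have "a \<in> (F ^^ j) ` cball x' (r x')"
        unfolding b(3) using x'(2) by (intro imageI) auto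
      ultimately have "a \<in> (F ^^ i) ` cball x (r x) \<inter> (F ^^ j) ` cball x (r x)"
        by simp
      then show False
        using r(2)[of x] X(1) x(1) ij unfolding disjoint_family_on_def by blast
    qed
    show "h -` {y} \<subseteq> (\<Union>i<p. (F ^^ i) ` E)"
    proof
      fix a assume "a \<in> h -` {y}"
      then have ha: "h a = y" by simp
      then have "a \<in> U" using \<epsilon>(3)[of a] h(3)[of a] by (simp add: dist_commute)
      then obtain z where z: "z \<in> X" "a \<in> cball z (r z)" by (auto simp: U_def less_imp_le)
      then have "(F ^^ 0) a \<in> cball z (r z)" by simp
      then have ex: "z \<in> X \<and> a \<in> sat (cball z (r z))" using z(1) unfolding sat_def by blast
      then obtain x where x: "x \<in> X" "a \<in> sat (cball x (r x))"
        and least: "\<And>z. z \<in> X \<and> a \<in> sat (cball z (r z)) \<Longrightarrow> e x \<le> e z"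
        using ex_has_least_nat[of "\<lambda>z. z \<in> X \<and> a \<in> sat (cball z (r z))" z e, OF ex] by blast
      obtain k where k: "(F ^^ k) a \<in> cball x (r x)" using x(2) by (auto simp: sat_def)
      have "(F ^^ k) a \<notin> sphere x (r x)" using hS[OF x(1)] hk ha by metis
      then have "(F ^^ k) a \<in> ball x (r x)" using k by (auto simp: less_le)
      moreover have "(F ^^ k) a \<notin> sat (cball z (r z))" if "z \<in> X" "e z < e x" for z
        using least[of z] that sat_inv by auto
      ultimately have "(F ^^ k) a \<in> E" using x(1) by (auto simp: E_def)
      moreover have "a = (F ^^ ((p * k - k) mod p)) ((F ^^ k) a)"
        using unwind modp by simp
      ultimately show "a \<in> (\<Union>i<p. (F ^^ i) ` E)"
        using p0 by (intro UN_I[of "(p * k - k) mod p"]) auto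
    qed
  qed
qed

text \<open>A power of \<open>F\<close> has prime period, hence is the identity; this lowers the period of \<open>F\<close>.\<close>

theorem bounded_displacement_finite_period:
  fixes F :: "'a::euclidean_space \<Rightarrow> 'a"
  assumes n: "n > 0" and F: "continuous_on UNIV F" "F ^^ n = id" "\<And>x. dist (F x) x \<le> C"
  shows "F = id"
  using n F(2)
proof (induction n rule: less_induct)
  case (less n)
  show ?case
  proof (cases "n = 1")
    case False
    then obtain p where p: "prime p" "p dvd n" using prime_factor_nat by blast
    then obtain m where m: "n = m * p" by (metis dvdE mult.commute)
    have "(F ^^ m) ^^ p = id" using less.prems(2) unfolding m by (simp only: funpow_mult)
    then have "F ^^ m = id"
      using bounded_displacement_prime_period[OF p(1) continuous_on_funpow[OF F(1)], of m "m * C"]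
        dist_funpow_le[of F C m] F(3) by blast
    moreover have "m < n" "m > 0" using less.prems(1) m p(1) prime_gt_1_nat by auto
    ultimately show ?thesis using less.IH by blast
  qed (use less in simp)
qed

section \<open>Periodic groups that are virtually abelian\<close>

lemma (in comm_group) finite_generate_periodic:
  assumes "finite X" "X \<subseteq> carrier G"
    and per: "\<And>x. x \<in> X \<Longrightarrow> \<exists>n::nat. n > 0 \<and> x [^] n = \<one>"
  shows "finite (generate G X)"
  using assms
proof (induction X)
  case empty
  then show ?case by (simp add: generate_empty)
next
  case (insert x X)
  let ?P = "generate G X"
  have x: "x \<in> carrier G" and X: "X \<subseteq> carrier G" using insert by auto
  have sg: "subgroup ?P G" by (rule generate_is_subgroup[OF X])
  have Pc: "?P \<subseteq> carrier G" using sg by (rule subgroup.subset)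
  obtain n :: nat where n: "n > 0" "x [^] n = \<one>" using insert.prems(2) by blast
  have powred: "x [^] k = x [^] (k mod n)" for k :: nat
  proof -
    have "x [^] k = x [^] (n * (k div n) + k mod n)" by simp
    also have "\<dots> = (x [^] n) [^] (k div n) \<otimes> x [^] (k mod n)"
      using x by (simp only: nat_pow_mult[symmetric] nat_pow_pow)
    finally show ?thesis using x n by simp
  qed
  let ?Q = "(\<lambda>(k, g). x [^] (k::nat) \<otimes> g) ` ({..<n} \<times> ?P)"
  have Q: "x [^] k \<otimes> g \<in> ?Q" if "g \<in> ?P" for k :: nat and g
    using that n by (subst powred) (auto intro!: image_eqI[of _ _ "(k mod n, g)"])
  have PQ: "g \<in> ?Q" if "g \<in> ?P" for g
  proof -
    have "x [^] (0::nat) \<otimes> g = g" using Pc that by auto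
    then show ?thesis using Q[OF that, of 0] by (simp only:)
  qed
  have "generate G (insert x X) \<subseteq> ?Q"
  proof
    fix g assume "g \<in> generate G (insert x X)"
    then show "g \<in> ?Q"
    proof (induction rule: generate.induct)
      case one
      show ?case using Q[OF generate.one, of 0] by simp
    next
      case (incl h)
      have "x [^] (1::nat) \<otimes> \<one> = x" using x by simp
      then have "x \<in> ?Q" using Q[OF generate.one, of 1] by (simp only:)
      then show ?case using incl PQ[OF generate.incl] by blast
    next
      case (inv h)
      show ?case
      proof (cases "h = x")
        case True
        have "x [^] (n - 1) \<otimes> x = \<one>"
          using n x by (metis One_nat_def Suc_pred nat_pow_Suc)
        then have "inv x = x [^] (n - 1)" using x by (intro inv_equality) auto
        then show ?thesis using Q[OF generate.one, of "n - 1"] x True by simp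
      next
        case False
        then show ?thesis using inv PQ[OF generate.inv] by blast
      qed
    next
      case (eng h1 h2)
      then obtain k1 k2 g1 g2 where h: "h1 = x [^] (k1::nat) \<otimes> g1" "h2 = x [^] (k2::nat) \<otimes> g2"
        and g: "g1 \<in> ?P" "g2 \<in> ?P" by auto
      have gc: "g1 \<in> carrier G" "g2 \<in> carrier G" using g Pc by auto
      have "h1 \<otimes> h2 = x [^] (k1 + k2) \<otimes> (g1 \<otimes> g2)"
        unfolding h using x gc by (simp add: nat_pow_mult[symmetric] m_ac)
      then show ?case using Q[OF generate.eng[OF g], of "k1 + k2"] by simp
    qed
  qed
  moreover have "finite ?Q"
    using insert X by auto
  ultimately show ?case by (rule finite_subset)
qed

text \<open>Schreier's argument. For a finite transversal \<open>T\<close> of \<open>N\<close>, every product \<open>t \<otimes> s\<close> of a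
  representative with a generator is a correction in \<open>N\<close> times another representative. The
  finitely many corrections generate a finite group \<open>P\<close>, because \<open>N\<close> is abelian and periodic, and
  \<open>P\<close> times \<open>T\<close> is stable under right multiplication by generators. Finiteness of the index is
  expressed by a map \<open>\<phi>\<close> with finite image whose fibres lie in single cosets.\<close>

lemma (in group) finite_if_abelian_finite_index:
  assumes S: "finite S" "S \<subseteq> carrier G" "generate G S = carrier G"
    and per: "\<And>x. x \<in> carrier G \<Longrightarrow> \<exists>n::nat. n > 0 \<and> x [^] n = \<one>"
    and N: "subgroup N G" and comm: "\<And>x y. x \<in> N \<Longrightarrow> y \<in> N \<Longrightarrow> x \<otimes> y = y \<otimes> x"
    and fin: "finite (\<phi> ` carrier G)"
    and fibre: "\<And>x y. x \<in> carrier G \<Longrightarrow> y \<in> carrier G \<Longrightarrow> \<phi> x = \<phi> y \<Longrightarrow> x \<otimes> inv y \<in> N"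
  shows "finite (carrier G)"
proof -
  let ?N = "G\<lparr>carrier := N\<rparr>"
  have "group ?N" by (rule subgroup.subgroup_is_group[OF N group_axioms])
  then interpret N: comm_group ?N
    by (rule group.group_comm_groupI) (simp add: comm)
  have Nc: "N \<subseteq> carrier G" by (rule subgroup.subset[OF N])
  define r where "r x = (SOME z. z \<in> carrier G \<and> \<phi> z = \<phi> x)" for x
  have r: "r x \<in> carrier G" "\<phi> (r x) = \<phi> x" if "x \<in> carrier G" for x
    using someI[of "\<lambda>z. z \<in> carrier G \<and> \<phi> z = \<phi> x" x] that by (auto simp: r_def)
  define T where "T = r ` carrier G"
  have Tc: "T \<subseteq> carrier G" using r by (auto simp: T_def)
  have "T \<subseteq> (\<lambda>c. SOME z. z \<in> carrier G \<and> \<phi> z = c) ` \<phi> ` carrier G"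
    by (auto simp: T_def r_def)
  then have Tfin: "finite T" using fin finite_subset by blast
  define S' where "S' = S \<union> m_inv G ` S"
  have S': "finite S'" "S' \<subseteq> carrier G" using S by (auto simp: S'_def)
  define X where "X = insert (inv (r \<one>)) ((\<lambda>(t, s). t \<otimes> s \<otimes> inv (r (t \<otimes> s))) ` (T \<times> S'))"
  have "inv (r \<one>) \<in> N"
    using fibre[of \<one> "r \<one>"] r[of \<one>] by simp
  moreover have "t \<otimes> s \<otimes> inv (r (t \<otimes> s)) \<in> N" if "t \<in> T" "s \<in> S'" for t s
    using fibre[of "t \<otimes> s" "r (t \<otimes> s)"] r[of "t \<otimes> s"] that Tc S' by auto
  ultimately have XN: "X \<subseteq> N" by (auto simp: X_def)
  define P where "P = generate ?N X"
  have pow_N: "x [^]\<^bsub>?N\<^esub> (n::nat) = x [^] n" for x n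
    by (induction n) auto
  have "finite P"
    unfolding P_def
  proof (rule N.finite_generate_periodic)
    show "finite X" using Tfin S' by (auto simp: X_def)
    show "\<exists>n::nat. n > 0 \<and> x [^]\<^bsub>?N\<^esub> n = \<one>\<^bsub>?N\<^esub>" if "x \<in> X" for x
      using per[of x] that XN Nc by (auto simp: pow_N)
  qed (use XN in simp)
  have Psub: "subgroup P ?N" unfolding P_def by (rule N.generate_is_subgroup) (use XN in simp)
  have PN: "P \<subseteq> N" using subgroup.subset[OF Psub] by simp
  have Pmult: "a \<otimes> b \<in> P" if "a \<in> P" "b \<in> P" for a b
    using subgroup.m_closed[OF Psub that] by simp
  have XP: "X \<subseteq> P" unfolding P_def by (auto intro: generate.incl)
  define PT where "PT = (\<lambda>(a, t). a \<otimes> t) ` (P \<times> T)"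
  have PTc: "PT \<subseteq> carrier G" using PN Nc Tc by (auto simp: PT_def)
  have step: "a \<otimes> s \<in> PT" if "a \<in> PT" "s \<in> S'" for a s
  proof -
    obtain b t where bt: "a = b \<otimes> t" "b \<in> P" "t \<in> T" using \<open>a \<in> PT\<close> by (auto simp: PT_def)
    have c: "b \<in> carrier G" "t \<in> carrier G" "s \<in> carrier G" "r (t \<otimes> s) \<in> carrier G"
    proof -
      show "b \<in> carrier G" using bt PN Nc by blast
      show t: "t \<in> carrier G" using bt Tc by blast
      show s: "s \<in> carrier G" using S' that by blast
      show "r (t \<otimes> s) \<in> carrier G" by (rule r(1)) (use t s in simp)
    qed
    have "a \<otimes> s = (b \<otimes> (t \<otimes> s \<otimes> inv (r (t \<otimes> s)))) \<otimes> r (t \<otimes> s)"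
      using c by (simp add: bt m_assoc)
    moreover have "t \<otimes> s \<otimes> inv (r (t \<otimes> s)) \<in> P" using XP bt that by (auto simp: X_def)
    moreover have "r (t \<otimes> s) \<in> T" using c by (auto simp: T_def)
    ultimately show ?thesis
      unfolding PT_def using Pmult[OF bt(2)]
      by (intro image_eqI[of _ _ "(b \<otimes> (t \<otimes> s \<otimes> inv (r (t \<otimes> s))), r (t \<otimes> s))"]) auto
  qed
  have absorb: "\<forall>a\<in>PT. a \<otimes> g \<in> PT" if "g \<in> generate G S" for g
    using that
  proof (induction rule: generate.induct)
    case one
    then show ?case using PTc by auto
  next
    case (eng h1 h2)
    have c: "h1 \<in> carrier G" "h2 \<in> carrier G"
      using eng.hyps generate_in_carrier[OF S(2)] by blast+
    then have "a \<otimes> (h1 \<otimes> h2) = (a \<otimes> h1) \<otimes> h2" if "a \<in> PT" for a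
      using that PTc by (auto simp: m_assoc)
    then show ?case using eng.IH by simp
  qed (use step in \<open>auto simp: S'_def\<close>)
  have "inv (r \<one>) \<otimes> r \<one> \<in> PT"
    using XP by (auto simp: PT_def X_def T_def)
  then have "\<one> \<in> PT" using r[of \<one>] by simp
  then have "g \<in> PT" if "g \<in> carrier G" for g
    using absorb[of g] that S(3) by (metis l_one)
  moreover have "finite PT" using \<open>finite P\<close> Tfin by (simp add: PT_def)
  ultimately show ?thesis by (meson finite_subset subsetI)
qed

section \<open>Lifting maps of the torus\<close>

definition int_vec :: "int ^ 'q \<Rightarrow> real ^ 'q"
  where "int_vec n = (\<chi> i. real_of_int (n $ i))"

lemma int_vec_simps [simp]:
  "int_vec n $ i = real_of_int (n $ i)" "int_vec 0 = 0"
  "int_vec (m + n) = int_vec m + int_vec n" "int_vec (m - n) = int_vec m - int_vec n"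
  by (simp_all add: int_vec_def vec_eq_iff)

lemma int_vec_eq_iff [simp]: "int_vec m = int_vec n \<longleftrightarrow> m = n"
  by (simp add: vec_eq_iff)

lemma abs_torus_eq_iff: "abs_torus x = abs_torus y \<longleftrightarrow> (\<exists>n. x = y + int_vec n)"
proof -
  have "torus_rel x y \<longleftrightarrow> (\<exists>n. x = y + int_vec n)"
  proof
    assume "torus_rel x y"
    then have "x = y + int_vec (\<chi> i. \<lfloor>x $ i - y $ i\<rfloor>)"
      by (simp add: torus_rel_def vec_eq_iff)
    then show "\<exists>n. x = y + int_vec n" by blast
  qed (auto simp: torus_rel_def)
  then show ?thesis by (simp add: torus.abs_eq_iff)
qed

lemma abs_torus_int_shift [simp]: "abs_torus (x + int_vec n) = abs_torus x"
  using abs_torus_eq_iff by blast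

lemma abs_rep_torus [simp]: "abs_torus (rep_torus t) = t"
  using Quotient_torus by (rule Quotient_abs_rep)

lemma rep_abs_torus: obtains n where "rep_torus (abs_torus x) = x + int_vec n"
  using abs_torus_eq_iff abs_rep_torus by blast

lemma continuous_on_abs_torus: "continuous_on S abs_torus"
proof -
  have "continuous_on UNIV (abs_torus :: real ^ 'q \<Rightarrow> 'q torus)"
    by (auto simp: continuous_on_open_vimage open_torus_def)
  then show ?thesis using continuous_on_subset by blast
qed

lemma continuous_on_torusI:
  assumes "continuous_on UNIV (\<lambda>x. g (abs_torus x))"
  shows "continuous_on UNIV g"
  using assms unfolding continuous_on_open_vimage[OF open_UNIV] open_torus_def
  by (simp add: vimage_def)

definition lifts :: "(real ^ 'q \<Rightarrow> real ^ 'q) \<Rightarrow> ('q::finite torus \<Rightarrow> 'q torus) \<Rightarrow> bool"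
  where "lifts F f \<longleftrightarrow> continuous_on UNIV F \<and> (\<forall>x. abs_torus (F x) = f (abs_torus x))"

text \<open>Each coordinate of \<open>f\<close>, seen as a map from the contractible \<open>\<real>\<^sup>q\<close> to the unit circle, has a
  continuous logarithm; its imaginary part divided by \<open>2 * pi\<close> is the coordinate of the lift.\<close>

lemma lift_exists:
  fixes f :: "'q::finite torus \<Rightarrow> 'q torus"
  assumes f: "continuous_on UNIV f"
  obtains F where "lifts F f"
proof -
  define e where "e k t = cis (2 * pi * rep_torus t $ k)" for k :: 'q and t
  have e_abs: "e k (abs_torus x) = cis (2 * pi * x $ k)" for k x
  proof -
    obtain n where "rep_torus (abs_torus x) = x + int_vec n" by (rule rep_abs_torus)
    then show ?thesis
      by (simp add: e_def distrib_left cis_mult[symmetric] cis_multiple_2pi)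
  qed
  have e_cont: "continuous_on UNIV (e k)" for k
    by (rule continuous_on_torusI) (simp add: e_abs cis_conv_exp, intro continuous_intros)
  have "\<exists>g. continuous_on UNIV g \<and> (\<forall>x. e k (f (abs_torus x)) = exp (g x))" for k
  proof (rule continuous_logarithm_on_contractible)
    show "continuous_on UNIV (\<lambda>x. e k (f (abs_torus x)))"
      by (intro continuous_on_compose2[OF e_cont] continuous_on_compose2[OF f] continuous_on_abs_torus) auto
    show "contractible (UNIV :: (real ^ 'q) set)" by (simp add: convex_imp_contractible)
    show "e k (f (abs_torus x)) \<noteq> 0" for x by (simp add: e_def)
  qed auto
  then obtain g where g: "\<And>k. continuous_on UNIV (g k)" "\<And>k x. e k (f (abs_torus x)) = exp (g k x)"
    by metis
  define F where "F x = (\<chi> k. Im (g k x) / (2 * pi))" for x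
  have "abs_torus (F x) = f (abs_torus x)" for x
  proof -
    let ?t = "f (abs_torus x)"
    have "rep_torus ?t $ k - F x $ k \<in> \<int>" for k
    proof -
      have "exp (Re (g k x)) = 1"
        using arg_cong[OF g(2)[of k x], of norm] by (simp add: e_def)
      then have "cis (2 * pi * rep_torus ?t $ k) = cis (Im (g k x))"
        using g(2)[of k x] by (simp add: e_def exp_eq_polar)
      then have "sin (2 * pi * rep_torus ?t $ k) = sin (Im (g k x)) \<and> cos (2 * pi * rep_torus ?t $ k) = cos (Im (g k x))"
        by (simp add: complex_eq_iff)
      then obtain n :: int where "2 * pi * rep_torus ?t $ k = Im (g k x) + 2 * pi * n"
        by (auto simp: sin_cos_eq_iff)
      then have "rep_torus ?t $ k - F x $ k = n"
        by (simp add: F_def field_simps)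
      then show ?thesis by simp
    qed
    then have "torus_rel (rep_torus ?t) (F x)" by (simp add: torus_rel_def)
    then show ?thesis by (metis abs_rep_torus torus.abs_eq_iff)
  qed
  moreover have "continuous_on UNIV F"
    unfolding F_def by (intro continuous_intros g continuous_on_vec_lambda) auto
  ultimately show thesis using that by (auto simp: lifts_def)
qed

text \<open>The difference of two lifts is continuous with values in the lattice, and \<open>\<real>\<^sup>q\<close> is connected.\<close>

lemma lift_unique:
  assumes F: "lifts F f" and G: "lifts G f"
  obtains n where "\<And>x. F x = G x + int_vec n"
proof -
  have "\<exists>n. F x = G x + int_vec n" for x
    using F G by (simp add: lifts_def abs_torus_eq_iff[symmetric])
  then obtain n where n: "\<And>x. F x = G x + int_vec (n x)" by metis
  have "(\<lambda>x. F x $ k - G x $ k) constant_on UNIV" for k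
  proof (rule continuous_discrete_range_constant)
    show "continuous_on UNIV (\<lambda>x. F x $ k - G x $ k)"
      using F G by (auto simp: lifts_def intro!: continuous_intros)
    show "\<exists>e>0. \<forall>y. y \<in> UNIV \<and> F y $ k - G y $ k \<noteq> F x $ k - G x $ k \<longrightarrow>
        e \<le> norm (F y $ k - G y $ k - (F x $ k - G x $ k))" for x
    proof (intro exI[of _ 1] conjI allI impI)
      fix y assume "y \<in> UNIV \<and> F y $ k - G y $ k \<noteq> F x $ k - G x $ k"
      then have "n y $ k \<noteq> n x $ k" using n by auto
      then have "1 \<le> \<bar>n y $ k - n x $ k\<bar>" by simp
      then have "(1::real) \<le> \<bar>real_of_int (n y $ k) - real_of_int (n x $ k)\<bar>" by linarith
      then show "1 \<le> norm (F y $ k - G y $ k - (F x $ k - G x $ k))" by (simp add: n)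
    qed simp
  qed (simp add: convex_connected)
  then have "F x $ k - G x $ k = F 0 $ k - G 0 $ k" for x k
    unfolding constant_on_def by (metis UNIV_I)
  then have "F x = G x + int_vec (n 0)" for x
    using n[of 0] by (simp add: vec_eq_iff) (metis add_diff_cancel_left' diff_add_cancel add.commute)
  then show thesis by (rule that)
qed

lemma lifts_compose: "lifts F f \<Longrightarrow> lifts G g \<Longrightarrow> lifts (F \<circ> G) (f \<circ> g)"
  by (auto simp: lifts_def comp_def intro: continuous_on_compose2)

lemma lifts_id: "lifts id id"
  by (simp add: lifts_def id_def)

lemma lifts_funpow: "lifts F f \<Longrightarrow> lifts (F ^^ n) (f ^^ n)"
  by (induction n) (auto intro: lifts_compose simp: lifts_id)

lemma lifts_shift: "lifts F f \<Longrightarrow> lifts (\<lambda>x. F x + int_vec n) f"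
  by (auto simp: lifts_def intro: continuous_intros)

definition equivariant :: "(real ^ 'q \<Rightarrow> real ^ 'q) \<Rightarrow> (int ^ 'q \<Rightarrow> int ^ 'q) \<Rightarrow> bool"
  where "equivariant F A \<longleftrightarrow> (\<forall>x n. F (x + int_vec n) = F x + int_vec (A n))"

lemma equivariant_unique: "equivariant F A \<Longrightarrow> equivariant F B \<Longrightarrow> A = B"
  by (fastforce simp: equivariant_def fun_eq_iff)

lemma equivariant_compose: "equivariant F A \<Longrightarrow> equivariant G B \<Longrightarrow> equivariant (F \<circ> G) (A \<circ> B)"
  by (simp add: equivariant_def)

lemma equivariant_additive:
  assumes "equivariant F A" shows "A (m + n) = A m + A n"
proof -
  have "F (0 + int_vec (m + n)) = F 0 + int_vec (A (m + n))"
    using assms unfolding equivariant_def by blast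
  moreover have "F (0 + int_vec m + int_vec n) = F (0 + int_vec m) + int_vec (A n)"
       "F (0 + int_vec m) = F 0 + int_vec (A m)"
    using assms unfolding equivariant_def by blast+
  ultimately have "int_vec (A (m + n)) = int_vec (A m + A n)" by (simp add: add.assoc)
  then show ?thesis by (simp only: int_vec_eq_iff)
qed

lemma lift_equivariant:
  assumes "lifts F f" obtains A where "equivariant F A"
proof -
  have "\<exists>m. \<forall>x. F (x + int_vec n) = F x + int_vec m" for n
  proof -
    have "lifts (\<lambda>x. F (x + int_vec n)) f"
      using assms by (auto simp: lifts_def intro!: continuous_on_compose2[of UNIV F] continuous_intros)
    from lift_unique[OF this assms] show ?thesis by metis
  qed
  then show thesis using that unfolding equivariant_def by metis
qed

text \<open>The map induced on \<open>H\<^sub>1\<close> of the torus, identified with the deck group \<open>\<int>\<^sup>q\<close>. It is the same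
  for all lifts, so that the choice is immaterial whenever \<open>f\<close> is continuous.\<close>

definition homology_action :: "('q::finite torus \<Rightarrow> 'q torus) \<Rightarrow> int ^ 'q \<Rightarrow> int ^ 'q"
  where "homology_action f = (SOME A. \<exists>F. lifts F f \<and> equivariant F A)"

lemma equivariant_homology_action:
  assumes F: "lifts F f" shows "equivariant F (homology_action f)"
proof -
  obtain A where "equivariant F A" using lift_equivariant[OF F] .
  then have "\<exists>F. lifts F f \<and> equivariant F (homology_action f)"
    unfolding homology_action_def using F by (intro someI[of "\<lambda>A. \<exists>F. lifts F f \<and> equivariant F A"]) blast
  then obtain G where G: "lifts G f" "equivariant G (homology_action f)" by blast
  obtain n where "\<And>x. F x = G x + int_vec n" using lift_unique[OF F G(1)] by metis
  then show ?thesis using G(2) by (simp add: equivariant_def)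
qed

lemma homology_action_eqI: "lifts F f \<Longrightarrow> equivariant F A \<Longrightarrow> homology_action f = A"
  using equivariant_homology_action equivariant_unique by blast

lemma homology_action_additive:
  "continuous_on UNIV f \<Longrightarrow> homology_action f (m + n) = homology_action f m + homology_action f n"
  using lift_exists equivariant_homology_action equivariant_additive by metis

lemma homology_action_compose:
  assumes "continuous_on UNIV f" "continuous_on UNIV g"
  shows "homology_action (f \<circ> g) = homology_action f \<circ> homology_action g"
proof -
  obtain F G where "lifts F f" "lifts G g" using assms lift_exists by metis
  then show ?thesis
    by (intro homology_action_eqI[OF lifts_compose] equivariant_compose equivariant_homology_action)
qed

lemma homology_action_id: "homology_action id = id"
  by (rule homology_action_eqI[OF lifts_id]) (simp add: equivariant_def)

lemma homology_action_funpow: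
  assumes "continuous_on UNIV f"
  shows "homology_action (f ^^ n) = homology_action f ^^ n"
proof (induction n)
  case (Suc n)
  then show ?case
    by (simp only: funpow.simps homology_action_compose[OF assms continuous_on_funpow[OF assms]])
qed (simp add: homology_action_id[unfolded id_def] id_def)

section \<open>Finite order automorphisms of the integer lattice\<close>

definition vec_dvd :: "int \<Rightarrow> int ^ 'q \<Rightarrow> bool"
  where "vec_dvd m v \<longleftrightarrow> (\<forall>i. m dvd v $ i)"

lemma vec_dvd_iff: "vec_dvd m v \<longleftrightarrow> (\<exists>w. v = m *s w)"
proof
  assume "vec_dvd m v"
  then have "\<forall>i. \<exists>w. v $ i = m * w" by (auto simp: vec_dvd_def dvd_def)
  then obtain w where "\<forall>i. v $ i = m * w i" by metis
  then show "\<exists>w. v = m *s w" by (intro exI[of _ "\<chi> i. w i"]) (simp add: vec_eq_iff)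
qed (auto simp: vec_dvd_def)

lemma vec_dvd_add: "vec_dvd m v \<Longrightarrow> vec_dvd m w \<Longrightarrow> vec_dvd m (v + w)"
  by (simp add: vec_dvd_def)

lemma vec_dvd_smult: "vec_dvd m v \<Longrightarrow> vec_dvd m (c *s v)"
  by (simp add: vec_dvd_def)

lemma additive_smult:
  fixes A :: "int ^ 'q \<Rightarrow> int ^ 'r"
  assumes "Modules.additive A"
  shows "A (c *s v) = c *s A v"
proof -
  interpret Modules.additive A by fact
  have nat: "A (int n *s v) = int n *s A v" for n
    by (induction n) (simp_all add: zero add vector_sadd_rdistrib)
  show ?thesis
  proof (cases c rule: int_cases2)
    case (nonneg n)
    then show ?thesis using nat by simp
  next
    case (nonpos n)
    have "c *s v = - (int n *s v)" "c *s A v = - (int n *s A v)"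
      using nonpos by (simp_all add: vec_eq_iff)
    then show ?thesis using nat by (simp add: minus)
  qed
qed

lemma additive_funpow:
  fixes A :: "'a::ab_group_add \<Rightarrow> 'a"
  assumes "Modules.additive A" shows "Modules.additive (A ^^ n)"
  using assms by (induction n) (auto simp: Modules.additive_def)

text \<open>The first-order expansion \<open>(1 + D)\<^sup>j = 1 + j D + \<dots>\<close> for \<open>D\<close> divisible by \<open>m\<close>; the remainder is
  divisible by the square of \<open>m\<close>.\<close>

lemma congruent_identity_funpow:
  fixes A :: "int ^ 'q \<Rightarrow> int ^ 'q"
  assumes A: "Modules.additive A" and m: "\<And>v. vec_dvd m (A v - v)"
  shows "vec_dvd (m * m) ((A ^^ j) v - v - int j *s (A v - v))"
proof (induction j)
  case 0
  then show ?case by (simp add: vec_dvd_def)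
next
  case (Suc j)
  interpret Modules.additive A by (rule A)
  define D where "D v = A v - v" for v
  define e where "e = (A ^^ j) v - v - int j *s D v"
  have "(A ^^ j) v = v + int j *s D v + e" by (simp add: e_def)
  then have "(A ^^ Suc j) v = A v + int j *s A (D v) + A e"
    by (simp add: add additive_smult[OF A])
  moreover have "A (D v) = D v + D (D v)" by (simp add: D_def)
  moreover have "int (Suc j) *s D v = D v + int j *s D v"
    by (simp add: vec_eq_iff algebra_simps)
  ultimately have eq: "(A ^^ Suc j) v - v - int (Suc j) *s D v = int j *s D (D v) + A e"
    by (simp add: D_def vec_eq_iff algebra_simps)
  obtain w where w: "D v = m *s w" using m[of v] by (auto simp: vec_dvd_iff D_def)
  obtain w' where w': "D w = m *s w'" using m[of w] by (auto simp: vec_dvd_iff D_def)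
  have "D (D v) = m *s D w"
    unfolding w by (simp add: D_def additive_smult[OF A] vec_eq_iff algebra_simps)
  then have "vec_dvd (m * m) (D (D v))" by (simp add: w' vec_dvd_def)
  moreover have "vec_dvd (m * m) (A e)"
    using Suc unfolding D_def[symmetric] e_def[symmetric]
    by (auto simp: vec_dvd_iff additive_smult[OF A])
  ultimately show ?case
    unfolding D_def[symmetric] eq by (intro vec_dvd_add vec_dvd_smult)
qed

text \<open>By induction it may be assumed that \<open>A\<close> has prime order \<open>r\<close>. If \<open>A - 1\<close> is divisible by \<open>3\<^sup>m\<close>, the
  expansion of \<open>A ^^ r\<close> shows that \<open>r (A - 1)\<close> is divisible by \<open>3\<close> to the power \<open>2 m\<close>. Hence
  \<open>A - 1\<close> is divisible by \<open>3\<close> to the power \<open>2 m - 1\<close>, which exceeds \<open>m\<close> as soon as \<open>m \<ge> 2\<close>;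
  this is why the modulus is 9. So \<open>A - 1\<close> is divisible by all powers of 3.\<close>

lemma finite_order_congruent_identity:
  fixes A :: "int ^ 'q \<Rightarrow> int ^ 'q"
  assumes "Modules.additive A" "N > 0" "A ^^ N = id" "\<And>v. vec_dvd 9 (A v - v)"
  shows "A = id"
  using assms
proof (induction N arbitrary: A rule: less_induct)
  case (less N)
  show ?case
  proof (cases "N = 1")
    case False
    then obtain r where r: "prime r" "r dvd N" using prime_factor_nat by blast
    then obtain M where M: "N = r * M" by (metis dvdE)
    have Ar: "A ^^ r = id"
    proof (rule less.IH)
      show "M < N" "M > 0" using less.prems(2) M r(1) prime_gt_1_nat by auto
      show "(A ^^ r) ^^ M = id" using less.prems(3) unfolding M by (simp only: funpow_mult mult.commute)
      show "Modules.additive (A ^^ r)" by (rule additive_funpow[OF less.prems(1)])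
      fix v
      have "vec_dvd 9 ((A ^^ r) v - v - int r *s (A v - v))"
        using congruent_identity_funpow[OF less.prems(1,4), of r v] unfolding vec_dvd_def
        by (blast intro: dvd_mult_left)
      then have "vec_dvd 9 ((A ^^ r) v - v - int r *s (A v - v) + int r *s (A v - v))"
        by (rule vec_dvd_add[OF _ vec_dvd_smult[OF less.prems(4)]])
      then show "vec_dvd 9 ((A ^^ r) v - v)" by simp
    qed
    have "vec_dvd (3 ^ (k + 2)) (A v - v)" for k v
    proof (induction k arbitrary: v)
      case 0
      then show ?case using less.prems(4) by simp
    next
      case (Suc k)
      let ?m = "3 ^ (k + 2) :: int"
      have "vec_dvd (?m * ?m) (- (int r *s (A v - v)))"
        using congruent_identity_funpow[OF less.prems(1) Suc, of r v] by (simp add: Ar)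
      then have dv: "?m * ?m dvd int r * (A v - v) $ i" for i
        by (simp only: vec_dvd_def vector_uminus_component vector_smult_component dvd_minus_iff)
      show ?case
        unfolding vec_dvd_def
      proof
        fix i
        define d where "d = (A v - v) $ i"
        have "?m * ?m = 3 * 3 ^ (2 * k + 3)"
        proof -
          have "k + 2 + (k + 2) = Suc (2 * k + 3)" by simp
          then show ?thesis unfolding power_add[symmetric] by (simp only: power_Suc)
        qed
        then have rd: "3 * 3 ^ (2 * k + 3) dvd int r * d"
          using dv[of i] by (simp only: d_def)
        have "3 ^ (2 * k + 3) dvd d"
        proof (cases "r = 3")
          case True
          then show ?thesis using rd by simp
        next
          case False
          then have "coprime 3 r" using r(1) by (intro primes_coprime) auto
          then have "coprime (int 3) (int r)" by (simp only: coprime_int_iff)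
          then have "coprime (3 ^ (2 * k + 3)) (int r)" by simp
          moreover have "3 ^ (2 * k + 3) dvd int r * d" using rd by (rule dvd_mult_right)
          ultimately show ?thesis using coprime_dvd_mult_right_iff by blast
        qed
        moreover have "(3::int) ^ (Suc k + 2) dvd 3 ^ (2 * k + 3)" by (intro le_imp_power_dvd) simp
        ultimately show "3 ^ (Suc k + 2) dvd (A v - v) $ i" unfolding d_def by (rule dvd_trans[rotated])
      qed
    qed
    then have dvd: "3 ^ (k + 2) dvd (A v - v) $ i" for k v i by (simp add: vec_dvd_def)
    have "(A v - v) $ i = 0" for v i
    proof (rule ccontr)
      assume nz: "(A v - v) $ i \<noteq> 0"
      define k where "k = nat \<bar>(A v - v) $ i\<bar>"
      have "3 ^ (k + 2) \<le> \<bar>(A v - v) $ i\<bar>"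
        using dvd_imp_le_int[OF nz dvd[of k v i]] by simp
      also have "\<dots> = int k" by (simp add: k_def)
      finally have "3 ^ (k + 2) \<le> k" by (metis of_nat_le_iff of_nat_numeral of_nat_power)
      moreover have "k < 3 ^ k" by (rule power_gt_expt) simp
      moreover have "(3::nat) ^ k \<le> 3 ^ (k + 2)" by (intro power_increasing) auto
      ultimately show False by linarith
    qed
    then show ?thesis by (auto simp: fun_eq_iff vec_eq_iff)
  qed (use less.prems in simp)
qed

lemma additive_congruent_on_basis:
  fixes A B :: "int ^ 'q::finite \<Rightarrow> int ^ 'q"
  assumes A: "Modules.additive A" and B: "Modules.additive B"
    and eq: "\<And>j. vec_dvd m (A (axis j 1) - B (axis j 1))"
  shows "vec_dvd m (A v - B v)"
proof -
  have expand: "C v = (\<Sum>j\<in>UNIV. v $ j *s C (axis j 1))" if C: "Modules.additive C" for C :: "int ^ 'q \<Rightarrow> int ^ 'q"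
  proof -
    have "C v = C (\<Sum>j\<in>UNIV. v $ j *s axis j 1)" by (simp only: basis_expansion)
    then show ?thesis by (simp add: Modules.additive.sum[OF C] additive_smult[OF C])
  qed
  have "A v - B v = (\<Sum>j\<in>UNIV. v $ j *s (A (axis j 1) - B (axis j 1)))"
    unfolding expand[OF A] expand[OF B] by (simp add: sum_subtractf[symmetric] vector_ssub_ldistrib)
  then have "(A v - B v) $ i = (\<Sum>j\<in>UNIV. v $ j * (A (axis j 1) - B (axis j 1)) $ i)" for i
    by (simp only: sum_component vector_smult_component)
  then show ?thesis
    using eq unfolding vec_dvd_def by (auto intro!: dvd_sum dvd_mult simp del: vector_minus_component)
qed

section \<open>Mean displacement\<close>

definition displacement :: "(real ^ 'q \<Rightarrow> real ^ 'q) \<Rightarrow> 'q::finite torus \<Rightarrow> real ^ 'q"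
  where "displacement F t = F (rep_torus t) - rep_torus t"

lemma displacement_abs_torus:
  assumes "equivariant F id" shows "displacement F (abs_torus x) = F x - x"
proof -
  obtain n where "rep_torus (abs_torus x) = x + int_vec n" by (rule rep_abs_torus)
  then show ?thesis using assms by (simp add: displacement_def equivariant_def)
qed

lemma continuous_displacement:
  assumes "lifts F f" "equivariant F id"
  shows "continuous_on UNIV (displacement F)"
  using assms by (intro continuous_on_torusI)
    (auto simp: displacement_abs_torus lifts_def intro!: continuous_intros)

lemma bounded_displacement:
  assumes "lifts F f" "equivariant F id"
  obtains C where "\<And>x. dist (F x) x \<le> C"
proof -
  have "continuous_on (cbox 0 1) (\<lambda>x. F x - x)"
    using assms(1) by (auto simp: lifts_def intro!: continuous_intros intro: continuous_on_subset)
  then have "bounded ((\<lambda>x. F x - x) ` cbox 0 1)"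
    using compact_continuous_image compact_cbox compact_imp_bounded by blast
  then obtain C where C: "\<And>x. x \<in> cbox 0 1 \<Longrightarrow> norm (F x - x) \<le> C"
    by (auto simp: bounded_iff)
  show thesis
  proof (rule that)
    fix x :: "real ^ 'a"
    define y where "y = (\<chi> i. frac (x $ i))"
    have "x = y + int_vec (\<chi> i. \<lfloor>x $ i\<rfloor>)" by (simp add: y_def vec_eq_iff frac_def)
    then have "F x - x = F y - y"
      using assms(2) by (metis (no_types, lifting) abs_torus_int_shift displacement_abs_torus)
    moreover have "y \<in> cbox 0 1" by (simp add: y_def mem_box_cart frac_lt_1 less_imp_le)
    ultimately show "dist (F x) x \<le> C" using C by (simp add: dist_norm)
  qed
qed

definition mean_displacement :: "'q::finite torus measure \<Rightarrow> (real ^ 'q \<Rightarrow> real ^ 'q) \<Rightarrow> real ^ 'q"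
  where "mean_displacement \<mu> F = integral\<^sup>L \<mu> (displacement F)"

lemma integrable_displacement:
  assumes "prob_space \<mu>" "sets \<mu> = sets borel" "lifts F f" "equivariant F id"
  shows "integrable \<mu> (displacement F)"
proof -
  interpret prob_space \<mu> by fact
  obtain C where C: "\<And>x. dist (F x) x \<le> C" using bounded_displacement[OF assms(3,4)] by metis
  have "displacement F \<in> borel_measurable \<mu>"
    unfolding measurable_cong_sets[OF assms(2) refl]
    by (rule borel_measurable_continuous_onI[OF continuous_displacement[OF assms(3,4)]])
  then show ?thesis
    by (rule integrable_const_bound[rotated, where B=C]) (use C in \<open>auto simp: displacement_def dist_norm\<close>)
qed

text \<open>The displacement of \<open>F \<circ> G\<close> is that of \<open>F\<close>, evaluated along \<open>g\<close>, plus that of \<open>G\<close>; the invariance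
  of \<open>\<mu>\<close> under \<open>g\<close> removes the \<open>g\<close> from the integral of the first term.\<close>

lemma mean_displacement_compose:
  assumes \<mu>: "prob_space \<mu>" "sets \<mu> = sets borel"
    and F: "lifts F f" "equivariant F id" and G: "lifts G g" "equivariant G id"
    and g: "continuous_on UNIV g" "distr \<mu> borel g = \<mu>"
  shows "mean_displacement \<mu> (F \<circ> G) = mean_displacement \<mu> F + mean_displacement \<mu> G"
proof -
  have GF: "displacement (F \<circ> G) t = displacement F (g t) + displacement G t" for t
  proof -
    have "g t = abs_torus (G (rep_torus t))"
      using G(1) by (simp add: lifts_def)
    then show ?thesis by (simp add: displacement_abs_torus[OF F(2)]) (simp add: displacement_def)
  qed
  have gm: "g \<in> measurable \<mu> borel"
    unfolding measurable_cong_sets[OF \<mu>(2) refl] by (rule borel_measurable_continuous_onI[OF g(1)])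
  have Fm: "displacement F \<in> borel_measurable borel"
    by (rule borel_measurable_continuous_onI[OF continuous_displacement[OF F]])
  have "integrable (distr \<mu> borel g) (displacement F)"
    unfolding g(2) by (rule integrable_displacement[OF \<mu> F])
  then have i: "integrable \<mu> (\<lambda>t. displacement F (g t))"
    by (simp add: integrable_distr_eq[OF gm Fm])
  have "displacement (F \<circ> G) = (\<lambda>t. displacement F (g t) + displacement G t)" using GF by blast
  then have "mean_displacement \<mu> (F \<circ> G) = (\<integral>t. displacement F (g t) \<partial>\<mu>) + (\<integral>t. displacement G t \<partial>\<mu>)"
    unfolding mean_displacement_def
    by (simp only: Bochner_Integration.integral_add[OF i integrable_displacement[OF \<mu> G]])
  also have "(\<integral>t. displacement F (g t) \<partial>\<mu>) = (\<integral>t. displacement F t \<partial>distr \<mu> borel g)"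
    by (rule integral_distr[OF gm Fm, symmetric])
  finally show ?thesis unfolding mean_displacement_def g(2) .
qed

lemma mean_displacement_translation:
  assumes "prob_space \<mu>"
  shows "mean_displacement \<mu> (\<lambda>x. x + int_vec n) = int_vec n"
proof -
  interpret prob_space \<mu> by fact
  have "displacement (\<lambda>x. x + int_vec n) = (\<lambda>t. int_vec n)"
    by (auto simp: displacement_def)
  then show ?thesis by (simp add: mean_displacement_def prob_space)
qed

lemma mean_displacement_shift:
  assumes "prob_space \<mu>" "sets \<mu> = sets borel" "lifts F f" "equivariant F id"
  shows "mean_displacement \<mu> (\<lambda>x. F x + int_vec n) = mean_displacement \<mu> F + int_vec n"
proof -
  interpret prob_space \<mu> by fact
  have "displacement (\<lambda>x. F x + int_vec n) = (\<lambda>t. displacement F t + int_vec n)"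
    by (auto simp: displacement_def)
  then show ?thesis
    using integrable_displacement[OF assms] by (simp add: mean_displacement_def prob_space)
qed

text \<open>The \<open>N\<close>-th power of \<open>V\<close> lifts the identity, so it is an integer translation, and its mean
  displacement 0 is the translation vector. Thus \<open>V\<close> has finite order itself.\<close>

lemma finite_order_zero_mean_displacement:
  assumes \<mu>: "prob_space \<mu>" "sets \<mu> = sets borel"
    and V: "lifts V w" "equivariant V id" and w: "continuous_on UNIV w" "distr \<mu> borel w = \<mu>"
    and N: "N > 0" "w ^^ N = id" and zero: "mean_displacement \<mu> V = 0"
  shows "w = id"
proof -
  have mean: "equivariant (V ^^ k) id \<and> mean_displacement \<mu> (V ^^ k) = 0" for k
  proof (induction k)
    case 0
    have "displacement (V ^^ 0) = (\<lambda>t. 0)" by (auto simp: displacement_def)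
    then have "mean_displacement \<mu> (V ^^ 0) = 0" by (simp only: mean_displacement_def) simp
    moreover have "equivariant (V ^^ 0) id" by (simp add: equivariant_def)
    ultimately show ?case by blast
  next
    case (Suc k)
    have Vk: "V ^^ Suc k = (V ^^ k) \<circ> V" by (simp add: funpow_Suc_right del: funpow.simps)
    have "equivariant ((V ^^ k) \<circ> V) id"
      using equivariant_compose[of "V ^^ k" id V id] Suc V(2) by simp
    moreover have "mean_displacement \<mu> ((V ^^ k) \<circ> V) = 0"
      using mean_displacement_compose[OF \<mu> lifts_funpow[OF V(1)] _ V w, of k] Suc zero by simp
    ultimately show ?case unfolding Vk by blast
  qed
  have "lifts (V ^^ N) id" using lifts_funpow[OF V(1), of N] N(2) by simp
  then obtain n where n: "\<And>x. (V ^^ N) x = id x + int_vec n"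
    using lift_unique[OF _ lifts_id] by metis
  then have "V ^^ N = (\<lambda>x. x + int_vec n)" by auto
  then have "int_vec n = 0" using mean[of N] mean_displacement_translation[OF \<mu>(1), of n] by simp
  then have VN: "V ^^ N = id" using n by auto
  obtain C where C: "\<And>x. dist (V x) x \<le> C" using bounded_displacement[OF V] by metis
  have "V = id"
    using bounded_displacement_finite_period[OF N(1) _ VN C] V(1) by (auto simp: lifts_def)
  then have "w (abs_torus x) = abs_torus x" for x using V(1) by (simp add: lifts_def)
  then show ?thesis by (metis abs_rep_torus eq_id_iff)
qed

section \<open>Finiteness of periodic groups of measure-preserving homeomorphisms\<close>

theorem theorem1p5:
  fixes \<mu> :: "('q::finite) torus measure" and H :: "('q torus \<Rightarrow> 'q torus) set"
  assumes "prob_space \<mu>" and "sets \<mu> = sets borel"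
    and "subgroup H (Homeo_preserving \<mu>)"
    and "finitely_generated_group ((Homeo_preserving \<mu>)\<lparr>carrier := H\<rparr>)"
    and "periodic_group ((Homeo_preserving \<mu>)\<lparr>carrier := H\<rparr>)"
  shows "finite H"
proof -
  note \<mu> = assms(1,2)
  let ?G = "(Homeo_preserving \<mu>)\<lparr>carrier := H\<rparr>"
  interpret G: group ?G
    by (rule subgroup.subgroup_is_group[OF assms(3) group_Homeo_preserving[OF \<mu>(2)]])
  have G_simps [simp]: "carrier ?G = H" "x \<otimes>\<^bsub>?G\<^esub> y = x \<circ> y" "\<one>\<^bsub>?G\<^esub> = id"
    "x \<otimes>\<^bsub>Homeo_preserving \<mu>\<^esub> y = x \<circ> y" "\<one>\<^bsub>Homeo_preserving \<mu>\<^esub> = id" for x y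
    by (simp_all add: Homeo_preserving_def)
  have pow: "f [^]\<^bsub>?G\<^esub> (n::nat) = f ^^ n" for f n
    by (induction n) (simp_all only: G.nat_pow_0 G.nat_pow_Suc G_simps funpow.simps(1) funpow_Suc_right)
  have "H \<subseteq> carrier (Homeo_preserving \<mu>)" by (rule subgroup.subset[OF assms(3)])
  then have cont: "continuous_on UNIV f" and pres: "distr \<mu> borel f = \<mu>" if "f \<in> H" for f
    using that by (auto simp: Homeo_preserving_def homeomorphism_def)
  have per: "\<exists>n>0. f ^^ n = id" if "f \<in> H" for f
    using assms(5) that unfolding periodic_group_def pow G_simps by blast
  have inv: "inv\<^bsub>?G\<^esub> f \<in> H" "f \<circ> inv\<^bsub>?G\<^esub> f = id" "inv\<^bsub>?G\<^esub> f \<circ> f = id" if "f \<in> H" for f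
    using G.inv_closed[of f] G.r_inv[of f] G.l_inv[of f] that by simp_all
  have mult: "f \<circ> g \<in> H" if "f \<in> H" "g \<in> H" for f g
    using G.m_closed[of f g] that by simp
  have add: "Modules.additive (homology_action f)" if "f \<in> H" for f
    using homology_action_additive[OF cont[OF that]] by (simp add: Modules.additive_def)
  have act_comp: "homology_action (f \<circ> g) = homology_action f \<circ> homology_action g" if "f \<in> H" "g \<in> H" for f g
    using homology_action_compose cont that by blast
  have inv_act: "homology_action (inv\<^bsub>?G\<^esub> k) = id" if "k \<in> H" "homology_action k = id" for k
    using act_comp[OF that(1) inv(1)[OF that(1)]]
    unfolding inv(2)[OF that(1)] that(2) homology_action_id id_comp by (rule sym)
  define N where "N = {f \<in> H. homology_action f = id}"
  have N_cong: "f \<in> N" if fH: "f \<in> H" and cong: "\<And>v. vec_dvd 9 (homology_action f v - v)" for f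
  proof -
    obtain n where n: "n > 0" "f ^^ n = id" using per[OF fH] by blast
    have "homology_action f ^^ n = id"
      using homology_action_funpow[OF cont[OF fH], of n] unfolding n(2) homology_action_id by (rule sym)
    from finite_order_congruent_identity[OF add[OF fH] n(1) this cong] show ?thesis
      using fH by (simp add: N_def)
  qed
  have N_comm: "f \<circ> g = g \<circ> f" if "f \<in> N" "g \<in> N" for f g
  proof -
    have fg: "f \<in> H" "g \<in> H" "homology_action f = id" "homology_action g = id" using that by (auto simp: N_def)
    \<comment> \<open>compare the commutator of \<open>f\<close> and \<open>g\<close> with a lift built from lifts of the four factors\<close>
    define f' g' where "f' = inv\<^bsub>?G\<^esub> f" and "g' = inv\<^bsub>?G\<^esub> g"
    have f': "f' \<in> H" "homology_action f' = id" "f \<circ> f' = id" and g': "g' \<in> H" "homology_action g' = id" "g \<circ> g' = id"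
      using inv inv_act fg by (auto simp: f'_def g'_def)
    obtain F F' G G' where L: "lifts F f" "lifts F' f'" "lifts G g" "lifts G' g'"
      using lift_exists cont fg f' g' by metis
    have E: "equivariant F id" "equivariant F' id" "equivariant G id" "equivariant G' id"
      using L equivariant_homology_action fg f' g' by metis+
    let ?m = "mean_displacement \<mu>"
    have inverse_mean: "\<exists>n. ?m K + ?m K' = int_vec n"
      if "lifts K k" "lifts K' k'" "equivariant K id" "equivariant K' id" "k \<circ> k' = id" "k' \<in> H" for K K' k k'
    proof -
      have "lifts (K \<circ> K') id" using lifts_compose[OF that(1,2)] that(5) by simp
      then obtain n where "\<And>x. (K \<circ> K') x = id x + int_vec n" using lift_unique[OF _ lifts_id] by metis
      then have "K \<circ> K' = (\<lambda>x. x + int_vec n)" by auto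
      then show ?thesis
        using mean_displacement_compose[OF \<mu> that(1,3,2,4) cont pres] that(6) mean_displacement_translation[OF \<mu>(1), of n] by metis
    qed
    obtain n n' where n: "?m F + ?m F' = int_vec n" "?m G + ?m G' = int_vec n'"
      using inverse_mean[OF L(1,2) E(1,2) f'(3,1)] inverse_mean[OF L(3,4) E(3,4) g'(3,1)] by blast
    define W where "W = F \<circ> (G \<circ> (F' \<circ> G'))"
    define w where "w = f \<circ> (g \<circ> (f' \<circ> g'))"
    have wH: "w \<in> H" unfolding w_def by (intro mult fg f' g')
    have W: "lifts W w" unfolding W_def w_def by (intro lifts_compose L)
    have E2: "equivariant (F' \<circ> G') id" "equivariant (G \<circ> (F' \<circ> G')) id" "equivariant W id"
      unfolding W_def using E by (simp_all add: equivariant_def)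
    have "?m W = ?m F + (?m G + (?m F' + ?m G'))"
      unfolding W_def
      using mean_displacement_compose[OF \<mu> L(2) E(2) L(4) E(4) cont pres]
        mean_displacement_compose[OF \<mu> L(3) E(3) lifts_compose[OF L(2,4)] E2(1) cont pres]
        mean_displacement_compose[OF \<mu> L(1) E(1) lifts_compose[OF L(3) lifts_compose[OF L(2,4)]] E2(2) cont pres]
        g'(1) mult fg f' by simp
    also have "\<dots> = int_vec n + int_vec n'"
      unfolding n[symmetric] by (simp add: algebra_simps)
    finally have mW: "?m W = int_vec (n + n')" by simp
    \<comment> \<open>the mean displacement of \<open>W\<close> is an integer vector, so an integer shift makes it vanish\<close>
    define c where "c = - (n + n')"
    define V where "V x = W x + int_vec c" for x
    have V: "lifts V w" "equivariant V id"
      using lifts_shift[OF W, of c] E2(3) by (simp_all add: V_def[abs_def] equivariant_def)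
    have "?m V = 0"
      unfolding V_def mean_displacement_shift[OF \<mu> W E2(3)] mW int_vec_simps(3)[symmetric] c_def by simp
    moreover obtain k where "k > 0" "w ^^ k = id" using per[OF wH] by blast
    ultimately have "w = id"
      using finite_order_zero_mean_displacement[OF \<mu> V cont[OF wH] pres[OF wH]] by blast
    then have w: "f (g (f' (g' t))) = t" for t by (simp add: w_def fun_eq_iff)
    have "f' (f t) = t" "g' (g t) = t" for t
      using inv(3)[OF fg(1)] inv(3)[OF fg(2)] by (simp_all add: f'_def g'_def fun_eq_iff)
    then have "f (g t) = g (f t)" for t using w[of "g (f t)"] by simp
    then show ?thesis by auto
  qed
  \<comment> \<open>the matrix of the action modulo 9\<close>
  define \<phi> where "\<phi> f = (\<lambda>(i, j). homology_action f (axis j 1) $ i mod 9)" for f :: "'q torus \<Rightarrow> 'q torus"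
  obtain S where S: "finite S" "S \<subseteq> H" "generate ?G S = H"
    using assms(4) by (auto simp: finitely_generated_group_def)
  have "finite (carrier ?G)"
  proof (rule G.finite_if_abelian_finite_index[where S=S and N=N and \<phi>=\<phi>])
    show "subgroup N ?G"
    proof (rule G.subgroupI)
      show "N \<noteq> {}" using G.one_closed homology_action_id by (auto simp: N_def)
      show "inv\<^bsub>?G\<^esub> f \<in> N" if "f \<in> N" for f
        using that inv(1)[of f] inv_act[of f] by (simp add: N_def)
      show "f \<otimes>\<^bsub>?G\<^esub> g \<in> N" if "f \<in> N" "g \<in> N" for f g
        using that act_comp[of f g] mult by (simp add: N_def)
    qed (auto simp: N_def)
    have "\<phi> ` H \<subseteq> (\<Pi>\<^sub>E p\<in>UNIV. {0..<9})"
      by (auto simp: \<phi>_def)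
    moreover have "finite (\<Pi>\<^sub>E p\<in>(UNIV :: ('q \<times> 'q) set). {0..<9::int})"
      by (intro finite_PiE) auto
    ultimately show "finite (\<phi> ` carrier ?G)" by (simp add: finite_subset)
    fix f g assume fg: "f \<in> carrier ?G" "g \<in> carrier ?G" and eq: "\<phi> f = \<phi> g"
    then have H: "f \<in> H" "g \<in> H" by simp_all
    let ?g = "inv\<^bsub>?G\<^esub> g"
    have basis: "vec_dvd 9 (homology_action f (axis j 1) - homology_action g (axis j 1))" for j
      using eq by (auto simp: vec_dvd_def \<phi>_def fun_eq_iff mod_eq_dvd_iff)
    have "f \<circ> ?g \<in> N"
    proof (rule N_cong)
      show "f \<circ> ?g \<in> H" using H inv mult by blast
      fix v
      have "homology_action g \<circ> homology_action ?g = id"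
        using act_comp[OF H(2) inv(1)[OF H(2)]] unfolding inv(2)[OF H(2)] homology_action_id by (rule sym)
      then have "homology_action g (homology_action ?g v) = v"
        by (metis comp_apply id_apply)
      then show "vec_dvd 9 (homology_action (f \<circ> ?g) v - v)"
        using additive_congruent_on_basis[OF add[OF H(1)] add[OF H(2)] basis, of "homology_action ?g v"]
        by (simp add: act_comp[OF H(1) inv(1)[OF H(2)]])
    qed
    then show "f \<otimes>\<^bsub>?G\<^esub> ?g \<in> N" by simp
  qed (use S per N_comm in \<open>simp_all add: pow\<close>)
  then show ?thesis by simp
qed

end
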